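(* Let $k$ and $\ell$ be positive integers. Suppose that $\sigma \subseteq \mathbb{C}$ is a $k$-ray set and that $\tau \subseteq \mathbb{C}$ is an $\ell$-ray set. Then $BV(\sigma) \simeq BV(\tau)$ (isomorphic as Banach algebras) if and only if $k = \ell$.
   Context: Identify $\mathbb{C}$ with $\mathbb{R}^2$. Let $\sigma$ be a nonempty compact subset of the plane; all functions are complex-valued. Variation factor. Let $S=[x_0,x_1,\dots,x_n]$ be a finite ordered list of (not necessarily distinct) elements of $\sigma$, $n\ge 1$. For $f:\sigma\to\mathbb{C}$ put $\mathrm{cvar}(f,S)=\sum_{i=1}^n |f(x_i)-f(x_{i-1})|$. For a line $L$ in the plane, the segment from $x_i$ to $x_{i+1}$ ($0\le i\le n-1$) is a crossing segment of $S$ on $L$ if any one of the following holds: (i) $x_i$ and $x_{i+1}$ lie on strictly opposite sides of $L$; (ii) $i=0$ and $x_i\in L$; (iii) $i>0$, $x_i\in L$ and $x_{i-1}\notin L$; (iv) $i=n-1$, $x_i\notin L$ and $x_{i+1}\in L$. Let $\mathrm{vf}(S,L)$ be the number of indices $i$ giving a crossing segment of $S$ on $L$, and $\mathrm{vf}(S)=\max_L \mathrm{vf}(S,L)$ over all lines $L$. For a one-element list, $\mathrm{cvar}(f,[x_0])=0$ and $\mathrm{vf}([x_0])=1$. The spaces. $\mathrm{var}(f,\sigma)=\sup_S \mathrm{cvar}(f,S)/\mathrm{vf}(S)$, the supremum being over all finite ordered lists of elements of $\sigma$; $\|f\|_{BV(\sigma)}=\|f\|_\infty+\mathrm{var}(f,\sigma)$;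 $BV(\sigma)=\{f:\sigma\to\mathbb{C} : \|f\|_{BV(\sigma)}<\infty\}$, which is a Banach algebra under pointwise operations. For Banach algebras $\mathcal{A},\mathcal{B}$, write $\mathcal{A}\simeq\mathcal{B}$ if there is a linear multiplicative bijection $\Phi:\mathcal{A}\to\mathcal{B}$ with $\Phi$ and $\Phi^{-1}$ continuous (not necessarily isometric). A $C$-set is a countably infinite compact subset of $\mathbb{C}$ with unique limit point $0$. For $\theta\in[0,2\pi)$ let $R_\theta=\{te^{i\theta}: t\ge 0\}$. For a positive integer $k$, a $C$-set $\sigma$ is a $k$-ray set if there are $k$ distinct rays $R_{\theta_1},\dots,R_{\theta_k}$ such that $\sigma_j:=\sigma\cap R_{\theta_j}$ is infinite for each $j=1,\dots,k$, and $\sigma_0:=\sigma\setminus(\sigma_1\cup\dots\cup\sigma_k)$ is finite. *)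

theory Defs
  imports "HOL-Analysis.Analysis"
begin

text \<open>A line in the plane is a set \<^term>\<open>{z. a \<bullet> z = b}\<close> with \<^prop>\<open>a \<noteq> (0::complex)\<close>,
  and is represented by the pair of \<open>a\<close> and \<open>b\<close>; its two open sides are given by the sign
  of \<^term>\<open>a \<bullet> z - b\<close>.\<close>

definition line :: "complex \<Rightarrow> real \<Rightarrow> complex set" where
  "line a b = {z. a \<bullet> z = b}"

definition opposite_sides :: "complex \<Rightarrow> real \<Rightarrow> complex \<Rightarrow> complex \<Rightarrow> bool" where
  "opposite_sides a b x y \<longleftrightarrow>
     (a \<bullet> x < b \<and> b < a \<bullet> y) \<or> (a \<bullet> y < b \<and> b < a \<bullet> x)"

text \<open>A list \<open>[x\<^sub>0, \<dots>, x\<^sub>n]\<close> has length \<open>n + 1\<close>, so the last segment has index \<open>length S - 2\<close>.\<close>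

definition crossing_segment :: "complex list \<Rightarrow> complex \<Rightarrow> real \<Rightarrow> nat \<Rightarrow> bool" where
  "crossing_segment S a b i \<longleftrightarrow>
     opposite_sides a b (S ! i) (S ! Suc i)
   \<or> (i = 0 \<and> S ! i \<in> line a b)
   \<or> (i > 0 \<and> S ! i \<in> line a b \<and> S ! (i - 1) \<notin> line a b)
   \<or> (i = length S - 2 \<and> S ! i \<notin> line a b \<and> S ! Suc i \<in> line a b)"

definition vf_on :: "complex list \<Rightarrow> complex \<Rightarrow> real \<Rightarrow> nat" where
  "vf_on S a b = card {i. Suc i < length S \<and> crossing_segment S a b i}"

text \<open>The values of \<^const>\<open>vf_on\<close> for a fixed list are less than its length, so the maximum below
  is over a finite nonempty set of naturals. It is positive for a nonempty list, since some line
  passes through the first point.\<close>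

definition vf :: "complex list \<Rightarrow> nat" where
  "vf S = (if length S = 1 then 1 else Max {vf_on S a b |a b. a \<noteq> 0})"

definition cvar :: "(complex \<Rightarrow> complex) \<Rightarrow> complex list \<Rightarrow> real" where
  "cvar f S = (\<Sum>i\<in>{1..<length S}. cmod (f (S ! i) - f (S ! (i - 1))))"

text \<open>The variation and the norm take values in \<^typ>\<open>ennreal\<close>, so that the supremum
  is meaningful for functions of unbounded variation.\<close>

definition bvar :: "complex set \<Rightarrow> (complex \<Rightarrow> complex) \<Rightarrow> ennreal" where
  "bvar \<sigma> f = (SUP S\<in>{S. S \<noteq> [] \<and> set S \<subseteq> \<sigma>}. ennreal (cvar f S / real (vf S)))"

definition bv_enorm :: "complex set \<Rightarrow> (complex \<Rightarrow> complex) \<Rightarrow> ennreal" where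
  "bv_enorm \<sigma> f = (SUP x\<in>\<sigma>. ennreal (cmod (f x))) + bvar \<sigma> f"

text \<open>A function on \<open>\<sigma>\<close> is represented by its extension by zero to the whole plane; with this
  convention the algebra operations are the pointwise ones.\<close>

definition BV :: "complex set \<Rightarrow> (complex \<Rightarrow> complex) set" where
  "BV \<sigma> = {f. (\<forall>x. x \<notin> \<sigma> \<longrightarrow> f x = 0) \<and> bv_enorm \<sigma> f < \<infinity>}"

definition bv_norm :: "complex set \<Rightarrow> (complex \<Rightarrow> complex) \<Rightarrow> real" where
  "bv_norm \<sigma> f = enn2real (bv_enorm \<sigma> f)"

definition bv_dist :: "complex set \<Rightarrow> (complex \<Rightarrow> complex) \<Rightarrow> (complex \<Rightarrow> complex) \<Rightarrow> real" where
  "bv_dist \<sigma> f g = bv_norm \<sigma> (\<lambda>x. f x - g x)"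

lemma cvar_nonneg: "0 \<le> cvar f S"
  unfolding cvar_def by (simp add: sum_nonneg)

lemma bv_enorm_lin:
  assumes "\<And>x. cmod (h x) \<le> cmod (f x) + cmod (g x)"
    and "\<And>x y. cmod (h x - h y) \<le> cmod (f x - f y) + cmod (g x - g y)"
  shows "bv_enorm \<sigma> h \<le> bv_enorm \<sigma> f + bv_enorm \<sigma> g"
proof -
  have 1: "(SUP x\<in>\<sigma>. ennreal (cmod (h x)))
      \<le> (SUP x\<in>\<sigma>. ennreal (cmod (f x))) + (SUP x\<in>\<sigma>. ennreal (cmod (g x)))"
  proof (rule SUP_least)
    fix x assume "x \<in> \<sigma>"
    have "ennreal (cmod (h x)) \<le> ennreal (cmod (f x)) + ennreal (cmod (g x))"
      using assms(1)[of x] by (simp flip: ennreal_plus add: ennreal_leI)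
    also have "\<dots> \<le> (SUP x\<in>\<sigma>. ennreal (cmod (f x))) + (SUP x\<in>\<sigma>. ennreal (cmod (g x)))"
      using \<open>x \<in> \<sigma>\<close> by (intro add_mono SUP_upper)
    finally show "ennreal (cmod (h x)) \<le> \<dots>" .
  qed
  have 2: "bvar \<sigma> h \<le> bvar \<sigma> f + bvar \<sigma> g"
    unfolding bvar_def
  proof (rule SUP_least)
    fix S assume S: "S \<in> {S. S \<noteq> [] \<and> set S \<subseteq> \<sigma>}"
    have "cvar h S \<le> cvar f S + cvar g S"
      unfolding cvar_def sum.distrib[symmetric] by (intro sum_mono assms(2))
    then have "cvar h S / real (vf S) \<le> cvar f S / real (vf S) + cvar g S / real (vf S)"
      unfolding add_divide_distrib[symmetric] by (intro divide_right_mono) auto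
    then have "ennreal (cvar h S / real (vf S))
        \<le> ennreal (cvar f S / real (vf S)) + ennreal (cvar g S / real (vf S))"
      by (simp add: cvar_nonneg ennreal_leI flip: ennreal_plus)
    also have "\<dots> \<le> (SUP S\<in>{S. S \<noteq> [] \<and> set S \<subseteq> \<sigma>}. ennreal (cvar f S / real (vf S)))
        + (SUP S\<in>{S. S \<noteq> [] \<and> set S \<subseteq> \<sigma>}. ennreal (cvar g S / real (vf S)))"
      using S by (intro add_mono SUP_upper)
    finally show "ennreal (cvar h S / real (vf S)) \<le> \<dots>" .
  qed
  show ?thesis
    unfolding bv_enorm_def using add_mono[OF 1 2] by (simp add: ac_simps)
qed

lemma BV_diff:
  assumes "f \<in> BV \<sigma>" "g \<in> BV \<sigma>"
  shows "(\<lambda>x. f x - g x) \<in> BV \<sigma>"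
proof -
  have "cmod (f x - g x - (f y - g y)) \<le> cmod (f x - f y) + cmod (g x - g y)" for x y
    using norm_triangle_ineq4[of "f x - f y" "g x - g y"] by (simp add: algebra_simps)
  then have "bv_enorm \<sigma> (\<lambda>x. f x - g x) \<le> bv_enorm \<sigma> f + bv_enorm \<sigma> g"
    by (intro bv_enorm_lin norm_triangle_ineq4)
  also have "\<dots> < \<infinity>"
    using assms by (simp add: BV_def)
  finally show ?thesis
    using assms by (auto simp: BV_def)
qed

lemma Metric_space_BV: "Metric_space (BV \<sigma>) (bv_dist \<sigma>)"
proof
  show "0 \<le> bv_dist \<sigma> f g" for f g
    by (simp add: bv_dist_def bv_norm_def)
  show "bv_dist \<sigma> f g = bv_dist \<sigma> g f" for f g
  proof -
    have *: "cmod (f x - g x - (f y - g y)) = cmod (g x - f x - (g y - f y))" for x y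
      using norm_minus_cancel[of "f x - g x - (f y - g y)"] by (simp add: algebra_simps)
    moreover have **: "cmod (f x - g x) = cmod (g x - f x)" for x
      by (rule norm_minus_commute)
    ultimately show ?thesis
      unfolding bv_dist_def bv_norm_def bv_enorm_def bvar_def cvar_def
      by (simp only: * **)
  qed
next
  fix f g assume fg: "f \<in> BV \<sigma>" "g \<in> BV \<sigma>"
  let ?h = "\<lambda>x. f x - g x"
  have h: "?h \<in> BV \<sigma>"
    using fg by (rule BV_diff)
  show "bv_dist \<sigma> f g = 0 \<longleftrightarrow> f = g"
  proof
    assume "bv_dist \<sigma> f g = 0"
    then have "bv_enorm \<sigma> ?h = 0"
      using h by (auto simp: bv_dist_def bv_norm_def BV_def enn2real_eq_0_iff)
    then have *: "(SUP x\<in>\<sigma>. ennreal (cmod (f x - g x))) = 0"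
      by (simp add: bv_enorm_def)
    have "f x = g x" if "x \<in> \<sigma>" for x
    proof -
      have "ennreal (cmod (f x - g x)) \<le> 0"
        using SUP_upper[OF that, of "\<lambda>x. ennreal (cmod (f x - g x))"] * by simp
      then show ?thesis by (simp add: ennreal_eq_0_iff)
    qed
    moreover have "f x = g x" if "x \<notin> \<sigma>" for x
      using fg that by (simp add: BV_def)
    ultimately show "f = g" by blast
  next
    assume "f = g"
    have "(SUP x\<in>\<sigma>. (0::ennreal)) \<le> 0" "bvar \<sigma> (\<lambda>x. 0) \<le> 0"
      unfolding bvar_def cvar_def by (rule SUP_least, simp)+
    then show "bv_dist \<sigma> f g = 0"
      using \<open>f = g\<close> by (simp add: bv_dist_def bv_norm_def bv_enorm_def)
  qed
next
  fix f g h assume "f \<in> BV \<sigma>" "g \<in> BV \<sigma>" "h \<in> BV \<sigma>"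
  then have fin: "bv_enorm \<sigma> (\<lambda>x. f x - g x) < \<infinity>" "bv_enorm \<sigma> (\<lambda>x. g x - h x) < \<infinity>"
    using BV_diff by (auto simp: BV_def)
  have "cmod (f x - h x) \<le> cmod (f x - g x) + cmod (g x - h x)" for x
    using norm_triangle_ineq[of "f x - g x" "g x - h x"] by simp
  moreover have "cmod (f x - h x - (f y - h y))
      \<le> cmod (f x - g x - (f y - g y)) + cmod (g x - h x - (g y - h y))" for x y
    using norm_triangle_ineq[of "f x - g x - (f y - g y)" "g x - h x - (g y - h y)"]
    by (simp add: algebra_simps)
  ultimately have "bv_enorm \<sigma> (\<lambda>x. f x - h x)
      \<le> bv_enorm \<sigma> (\<lambda>x. f x - g x) + bv_enorm \<sigma> (\<lambda>x. g x - h x)"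
    by (rule bv_enorm_lin)
  then have "enn2real (bv_enorm \<sigma> (\<lambda>x. f x - h x))
      \<le> enn2real (bv_enorm \<sigma> (\<lambda>x. f x - g x) + bv_enorm \<sigma> (\<lambda>x. g x - h x))"
    using fin by (intro enn2real_mono) (auto simp: less_top)
  then show "bv_dist \<sigma> f h \<le> bv_dist \<sigma> f g + bv_dist \<sigma> g h"
    using fin by (simp add: bv_dist_def bv_norm_def enn2real_plus)
qed

definition bv_topology :: "complex set \<Rightarrow> (complex \<Rightarrow> complex) topology" where
  "bv_topology \<sigma> = Metric_space.mtopology (BV \<sigma>) (bv_dist \<sigma>)"

text \<open>Isomorphism as Banach algebras, not necessarily isometric.\<close>

definition BV_isomorphic :: "complex set \<Rightarrow> complex set \<Rightarrow> bool" where
  "BV_isomorphic \<sigma> \<tau> \<longleftrightarrow>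
     (\<exists>\<Phi>. bij_betw \<Phi> (BV \<sigma>) (BV \<tau>)
        \<and> (\<forall>f\<in>BV \<sigma>. \<forall>g\<in>BV \<sigma>. \<Phi> (\<lambda>x. f x + g x) = (\<lambda>x. \<Phi> f x + \<Phi> g x))
        \<and> (\<forall>c. \<forall>f\<in>BV \<sigma>. \<Phi> (\<lambda>x. c * f x) = (\<lambda>x. c * \<Phi> f x))
        \<and> (\<forall>f\<in>BV \<sigma>. \<forall>g\<in>BV \<sigma>. \<Phi> (\<lambda>x. f x * g x) = (\<lambda>x. \<Phi> f x * \<Phi> g x))
        \<and> continuous_map (bv_topology \<sigma>) (bv_topology \<tau>) \<Phi>
        \<and> continuous_map (bv_topology \<tau>) (bv_topology \<sigma>) (inv_into (BV \<sigma>) \<Phi>))"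

definition C_set :: "complex set \<Rightarrow> bool" where
  "C_set \<sigma> \<longleftrightarrow> countable \<sigma> \<and> infinite \<sigma> \<and> compact \<sigma> \<and> (\<forall>x. x islimpt \<sigma> \<longleftrightarrow> x = 0)"

definition ray :: "real \<Rightarrow> complex set" where
  "ray \<theta> = {complex_of_real t * exp (\<i> * complex_of_real \<theta>) |t. t \<ge> 0}"

definition ray_set :: "nat \<Rightarrow> complex set \<Rightarrow> bool" where
  "ray_set k \<sigma> \<longleftrightarrow> C_set \<sigma> \<and>
     (\<exists>\<theta> :: nat \<Rightarrow> real.
        (\<forall>j\<in>{1..k}. 0 \<le> \<theta> j \<and> \<theta> j < 2 * pi)
      \<and> inj_on (\<lambda>j. ray (\<theta> j)) {1..k}
      \<and> (\<forall>j\<in>{1..k}. infinite (\<sigma> \<inter> ray (\<theta> j)))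
      \<and> finite (\<sigma> - (\<Union>j\<in>{1..k}. \<sigma> \<inter> ray (\<theta> j))))"

end

theory Submission
  imports Defs
begin

text \<open>Up to equivalence of norms, the algebra of a \<open>k\<close>-ray set does not see the plane. List the
  points on each ray by decreasing distance from \<open>0\<close>, after the finitely many exceptional points in
  the case of the first ray; this enumerates all points except \<open>0\<close> by \<open>k\<close> sequences. The norm
  is equivalent to the supremum of \<open>|f|\<close> combined with the ordinary variations of \<open>f\<close> along the
  sequences (\<open>bv_enorm_le\<close> and \<open>seq_bounded_of_bv_enorm_le\<close>).

  One inequality holds because a list that runs along a ray towards \<open>0\<close> crosses each line only
  a bounded number of times. For the other one, summation by parts writes \<open>f\<close> as a combination of the
  indicators of \<open>{0}\<close> and of initial segments of the sequences, with coefficients that the new norm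
  controls. Such a segment is, up to finitely many points, cut out of the set by a line and a
  half-plane, and all the switches of a finite list between a half-plane and its complement cross
  one and the same line parallel to the boundary. So the variations of these indicators are uniformly bounded.

  If \<open>k = l\<close>, the bijection between the two sets that matches \<open>0\<close> with \<open>0\<close> and the sequences with
  each other preserves the new norm, and composition with it is an isomorphism.

  Conversely, an isomorphism maps the \<open>k\<close> indicators of the sequences to orthogonal
  idempotents of infinite support. An idempotent has finitely many jumps along every sequence, so each
  of these images is eventually \<open>1\<close> along some sequence of the target, and orthogonality makes these
  \<open>k\<close> sequences distinct. Hence \<open>k \<le> l\<close>, and \<open>l \<le> k\<close> by the inverse isomorphism.\<close>

section \<open>The variation factor as a count of switches\<close>

definition switches :: "'a set \<Rightarrow> 'a list \<Rightarrow> nat" where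
  "switches A S = card {i. Suc i < length S \<and> (S ! i \<in> A) \<noteq> (S ! Suc i \<in> A)}"

text \<open>A list that switches \<open>N\<close> times between \<open>A\<close> and its complement gives the indicator of \<open>A\<close> the
  variation \<open>N\<close>, so \<^term>\<open>switch_bound \<sigma> C A\<close> says that this indicator has variation at most \<open>C\<close> on
  \<open>\<sigma>\<close>. The class of these sets contains the half-planes and is closed under the Boolean operations
  (with constants that add up), which makes it easy to reach rays, segments and points.\<close>

definition switch_bound :: "complex set \<Rightarrow> nat \<Rightarrow> complex set \<Rightarrow> bool" where
  "switch_bound \<sigma> C A \<longleftrightarrow> (\<forall>S. S \<noteq> [] \<and> set S \<subseteq> \<sigma> \<longrightarrow> switches A S \<le> C * vf S)"

lemma finite_segments: "finite {i. Suc i < length S \<and> P i}"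
  by (rule finite_subset[of _ "{..<length S}"]) auto

lemma vf_on_le_length: "vf_on S a b \<le> length S"
proof -
  have "vf_on S a b \<le> card {..<length S}"
    unfolding vf_on_def by (intro card_mono) auto
  then show ?thesis by simp
qed

lemma finite_vf_on: "finite {vf_on S a b |a b. a \<noteq> 0}"
  by (rule finite_subset[of _ "{..length S}"]) (auto simp: vf_on_le_length)

lemma vf_on_le_vf:
  assumes "a \<noteq> 0" and "length S \<noteq> 1"
  shows "vf_on S a b \<le> vf S"
  using assms finite_vf_on by (auto simp: vf_def intro!: Max_ge)

lemma vf_pos:
  assumes "S \<noteq> []"
  shows "vf S > 0"
proof (cases "length S = 1")
  case False
  with assms have len: "Suc 0 < length S"
    by (cases S) auto
  have "0 \<in> {i. Suc i < length S \<and> crossing_segment S 1 (1 \<bullet> (S ! 0)) i}"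
    using len by (simp add: crossing_segment_def line_def)
  then have "vf_on S 1 (1 \<bullet> (S ! 0)) > 0"
    unfolding vf_on_def using finite_segments card_gt_0_iff by blast
  then show ?thesis
    using vf_on_le_vf[of 1 S "1 \<bullet> (S ! 0)"] False by simp
qed (simp add: vf_def)

lemma vf_le:
  assumes "\<And>a b. vf_on S a b \<le> C" and "1 \<le> C"
  shows "vf S \<le> C"
proof -
  have "vf_on S 1 0 \<in> {vf_on S a b |a b. a \<noteq> 0}"
    by force
  then have "{vf_on S a b |a b. a \<noteq> 0} \<noteq> {}"
    by blast
  then show ?thesis
    using assms finite_vf_on by (auto simp: vf_def)
qed

text \<open>The boundary line of the half-plane may pass through points of the list, where a switch need
  not be a crossing. Since the list is finite, the line can be pushed into the open side so that it
  misses the list without changing the partition of the list; then every switch joins strictly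
  opposite sides.\<close>

lemma switches_open_halfplane_le_vf:
  assumes "a \<noteq> 0"
  shows "switches {z. b < a \<bullet> z} S \<le> vf S"
proof (cases "Suc 0 < length S")
  case False
  then have "switches {z. b < a \<bullet> z} S = 0"
    by (simp add: switches_def)
  then show ?thesis by simp
next
  case True
  define V where "V = {v \<in> (\<lambda>z. a \<bullet> z) ` set S. b < v}"
  define b' where "b' = (if V = {} then b + 1 else (b + Min V) / 2)"
  have fin: "finite V"
    by (simp add: V_def)
  have "b < b'"
  proof (cases "V = {}")
    case False
    then have "Min V \<in> V" using fin by simp
    then show ?thesis using False by (simp add: b'_def V_def)
  qed (simp add: b'_def)
  have above: "b' < v" if "v \<in> V" for v
  proof -
    have "Min V \<le> v" "b < v" using that fin by (auto simp: V_def)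
    then show ?thesis using that by (auto simp: b'_def)
  qed
  have side: "b' < a \<bullet> z" if "z \<in> set S" "b < a \<bullet> z" for z
    using above[of "a \<bullet> z"] that by (auto simp: V_def)
  have "{i. Suc i < length S \<and> (S ! i \<in> {z. b < a \<bullet> z}) \<noteq> (S ! Suc i \<in> {z. b < a \<bullet> z})}
      \<subseteq> {i. Suc i < length S \<and> crossing_segment S a b' i}"
  proof clarify
    fix i assume i: "Suc i < length S"
      and sw: "(S ! i \<in> {z. b < a \<bullet> z}) \<noteq> (S ! Suc i \<in> {z. b < a \<bullet> z})"
    have "S ! i \<in> set S" "S ! Suc i \<in> set S" using i by auto
    with sw side[of "S ! i"] side[of "S ! Suc i"] \<open>b < b'\<close>
    show "crossing_segment S a b' i"
      by (auto simp: crossing_segment_def opposite_sides_def)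
  qed
  then have "switches {z. b < a \<bullet> z} S \<le> vf_on S a b'"
    unfolding switches_def vf_on_def by (intro card_mono finite_segments)
  also have "\<dots> \<le> vf S"
    using assms True by (intro vf_on_le_vf) auto
  finally show ?thesis .
qed

lemma switch_bound_halfplane: "a \<noteq> 0 \<Longrightarrow> switch_bound \<sigma> 1 {z. b < a \<bullet> z}"
  by (simp add: switch_bound_def switches_open_halfplane_le_vf)

lemma switch_bound_mono:
  assumes "switch_bound \<sigma> C A" and "C \<le> D"
  shows "switch_bound \<sigma> D A"
  unfolding switch_bound_def
proof (intro allI impI)
  fix S assume "S \<noteq> [] \<and> set S \<subseteq> \<sigma>"
  then have "switches A S \<le> C * vf S"
    using assms(1) by (simp add: switch_bound_def)
  also have "\<dots> \<le> D * vf S"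
    using assms(2) by simp
  finally show "switches A S \<le> D * vf S" .
qed

lemma switches_cong:
  assumes "\<And>z. z \<in> set S \<Longrightarrow> z \<in> A \<longleftrightarrow> z \<in> B"
  shows "switches A S = switches B S"
proof -
  have "S ! i \<in> A \<longleftrightarrow> S ! i \<in> B" if "i < length S" for i
    using assms that by simp
  then show ?thesis
    unfolding switches_def by (intro arg_cong[where f = card] Collect_cong) (meson Suc_lessD)
qed

lemma switch_bound_cong:
  assumes "A \<inter> \<sigma> = B \<inter> \<sigma>"
  shows "switch_bound \<sigma> C A \<longleftrightarrow> switch_bound \<sigma> C B"
proof -
  have "switches A S = switches B S" if "set S \<subseteq> \<sigma>" for S
    using assms that by (intro switches_cong) auto
  then show ?thesis
    by (auto simp: switch_bound_def)
qed

lemma switch_bound_compl: "switch_bound \<sigma> C A \<Longrightarrow> switch_bound \<sigma> C (- A)"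
  by (simp add: switch_bound_def switches_def)

text \<open>A switch of the union is a switch of one of the two sets.\<close>

lemma switch_bound_Un:
  assumes "switch_bound \<sigma> C A" and "switch_bound \<sigma> D B"
  shows "switch_bound \<sigma> (C + D) (A \<union> B)"
  unfolding switch_bound_def
proof (intro allI impI)
  fix S assume S: "S \<noteq> [] \<and> set S \<subseteq> \<sigma>"
  have "switches (A \<union> B) S \<le> switches A S + switches B S"
    unfolding switches_def
    by (rule order_trans[OF card_mono card_Un_le]) (auto simp: finite_segments)
  also have "\<dots> \<le> C * vf S + D * vf S"
    using assms S by (intro add_mono) (auto simp: switch_bound_def)
  finally show "switches (A \<union> B) S \<le> (C + D) * vf S"
    by (simp add: algebra_simps)
qed

lemma switch_bound_Int:
  assumes "switch_bound \<sigma> C A" and "switch_bound \<sigma> D B"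
  shows "switch_bound \<sigma> (C + D) (A \<inter> B)"
  using switch_bound_compl[OF switch_bound_Un[OF switch_bound_compl[OF assms(1)]
    switch_bound_compl[OF assms(2)]]] by simp

lemma switch_bound_line:
  assumes "a \<noteq> 0"
  shows "switch_bound \<sigma> 2 {z. a \<bullet> z = b}"
proof -
  have "switch_bound \<sigma> (1 + 1) (- {z. b < a \<bullet> z} \<inter> - {z. - b < (- a) \<bullet> z})"
    using assms by (intro switch_bound_Int switch_bound_compl switch_bound_halfplane) auto
  also have "- {z. b < a \<bullet> z} \<inter> - {z. - b < (- a) \<bullet> z} = {z. a \<bullet> z = b}"
    by auto
  finally show ?thesis
    by (simp add: numeral_2_eq_2)
qed

lemma switch_bound_singleton: "switch_bound \<sigma> 4 {p}"
proof -
  have "switch_bound \<sigma> (2 + 2) ({z. 1 \<bullet> z = Re p} \<inter> {z. \<i> \<bullet> z = Im p})"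
    by (intro switch_bound_Int switch_bound_line) auto
  also have "{z. 1 \<bullet> z = Re p} \<inter> {z. \<i> \<bullet> z = Im p} = {p}"
    by (auto simp: inner_complex_def complex_eq_iff)
  finally show ?thesis by simp
qed

lemma switch_bound_empty: "switch_bound \<sigma> 0 {}"
  by (simp add: switch_bound_def switches_def)

lemma switch_bound_finite:
  assumes "finite A"
  shows "switch_bound \<sigma> (4 * card A) A"
  using assms
proof induction
  case (insert p A)
  then show ?case
    using switch_bound_Un[OF switch_bound_singleton[of \<sigma> p] insert.IH] by simp
qed (simp add: switch_bound_empty)

section \<open>The points of the set on one ray\<close>

text \<open>In this form the ray without its endpoint is visibly cut out by lines and half-planes.\<close>

lemma ray_nonzero_iff:
  "z \<in> ray \<theta> - {0} \<longleftrightarrow> (\<i> * cis \<theta>) \<bullet> z = 0 \<and> 0 < cis \<theta> \<bullet> z"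
proof
  assume "z \<in> ray \<theta> - {0}"
  then obtain t where "t \<ge> 0" "z = of_real t * cis \<theta>" "t \<noteq> 0"
    by (auto simp: ray_def cis_conv_exp)
  moreover have "cis \<theta> \<bullet> z = t"
    using \<open>z = _\<close> sin_cos_squared_add3[of \<theta>]
    by (simp add: inner_complex_def mult.left_commute[of _ t] flip: distrib_left)
  ultimately show "(\<i> * cis \<theta>) \<bullet> z = 0 \<and> 0 < cis \<theta> \<bullet> z"
    by (auto simp: inner_complex_def)
next
  define t where "t = cis \<theta> \<bullet> z"
  assume *: "(\<i> * cis \<theta>) \<bullet> z = 0 \<and> 0 < cis \<theta> \<bullet> z"
  have "(sin \<theta>)\<^sup>2 + (cos \<theta>)\<^sup>2 = 1" by simp
  with * have "Re z = t * cos \<theta>" "Im z = t * sin \<theta>"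
    unfolding t_def inner_complex_def by (simp_all, algebra+)
  then have "z = of_real t * cis \<theta>"
    by (simp add: complex_eq_iff)
  then show "z \<in> ray \<theta> - {0}"
    using * by (auto simp: ray_def cis_conv_exp t_def intro!: exI[of _ t])
qed

lemma ray_inner:
  assumes "z \<in> ray \<theta>"
  shows "cis \<theta> \<bullet> z = cmod z"
proof -
  obtain t where "t \<ge> 0" "z = of_real t * cis \<theta>"
    using assms by (auto simp: ray_def cis_conv_exp)
  then show ?thesis
    using sin_cos_squared_add3[of \<theta>]
    by (simp add: inner_complex_def norm_mult mult.left_commute[of _ t] flip: distrib_left)
qed

lemma ray_polar: "z \<in> ray \<theta> \<Longrightarrow> z = of_real (cmod z) * cis \<theta>"
  by (auto simp: ray_def cis_conv_exp norm_mult)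

lemma ray_disjoint:
  assumes "ray \<theta> \<noteq> ray \<eta>"
  shows "ray \<theta> \<inter> ray \<eta> \<subseteq> {0}"
proof
  fix z assume z: "z \<in> ray \<theta> \<inter> ray \<eta>"
  show "z \<in> {0}"
  proof (rule ccontr)
    assume "z \<notin> {0}"
    moreover have "of_real (cmod z) * cis \<theta> = of_real (cmod z) * cis \<eta>"
      using z ray_polar by (metis IntD1 IntD2)
    ultimately have "cis \<theta> = cis \<eta>" by simp
    then have "ray \<theta> = ray \<eta>"
      by (simp add: ray_def cis_conv_exp)
    with assms show False by simp
  qed
qed

lemma switch_bound_ray_segment:
  assumes "0 \<le> t"
  shows "switch_bound \<sigma> 3 {z \<in> ray \<theta>. t < cmod z}"
proof -
  have "switch_bound \<sigma> (2 + 1) ({z. (\<i> * cis \<theta>) \<bullet> z = 0} \<inter> {z. t < cis \<theta> \<bullet> z})"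
    by (intro switch_bound_Int switch_bound_line switch_bound_halfplane) auto
  also have "{z. (\<i> * cis \<theta>) \<bullet> z = 0} \<inter> {z. t < cis \<theta> \<bullet> z} = {z \<in> ray \<theta>. t < cmod z}"
  proof (intro set_eqI iffI)
    fix z assume z: "z \<in> {z. (\<i> * cis \<theta>) \<bullet> z = 0} \<inter> {z. t < cis \<theta> \<bullet> z}"
    then have "z \<in> ray \<theta>"
      using assms ray_nonzero_iff[of z \<theta>] by auto
    with z show "z \<in> {z \<in> ray \<theta>. t < cmod z}"
      by (simp add: ray_inner)
  next
    fix z assume z: "z \<in> {z \<in> ray \<theta>. t < cmod z}"
    then have "z \<in> ray \<theta> - {0}"
      using assms by auto
    with z show "z \<in> {z. (\<i> * cis \<theta>) \<bullet> z = 0} \<inter> {z. t < cis \<theta> \<bullet> z}"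
      using ray_nonzero_iff[of z \<theta>] by (simp add: ray_inner)
  qed
  finally show ?thesis by (simp add: numeral_3_eq_3)
qed

text \<open>Rank each element by the number of larger ones. The ranks form an infinite initial segment of
  the naturals, hence every natural is a rank, and the enumeration is the inverse of the rank.\<close>

lemma decreasing_enumeration:
  fixes A :: "real set"
  assumes "infinite A" and fin: "\<And>a. a \<in> A \<Longrightarrow> finite {b \<in> A. a \<le> b}"
  obtains r :: "nat \<Rightarrow> real" where "bij_betw r UNIV A" and "\<And>m n. m < n \<Longrightarrow> r n < r m"
proof -
  define rank where "rank a = card {b \<in> A. a < b}" for a
  have fin': "finite {b \<in> A. a < b}" if "a \<in> A" for a
    using fin[OF that] by (rule rev_finite_subset) auto
  have anti: "rank b < rank a" if "a \<in> A" "b \<in> A" "a < b" for a b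
    unfolding rank_def using that fin'[of a] by (intro psubset_card_mono) auto
  then have inj: "inj_on rank A"
    by (metis inj_onI less_irrefl linorder_neqE_linordered_idom)
  have pred: "n \<in> rank ` A" if "Suc n \<in> rank ` A" for n
  proof -
    obtain a where a: "a \<in> A" "rank a = Suc n"
      using \<open>Suc n \<in> rank ` A\<close> by force
    define U where "U = {b \<in> A. a < b}"
    have U: "finite U" "U \<noteq> {}"
      using a fin'[of a] by (auto simp: rank_def simp flip: U_def)
    define c where "c = Min U"
    have c: "c \<in> U" "\<And>u. u \<in> U \<Longrightarrow> c \<le> u"
      using U by (simp_all add: c_def)
    have "{b \<in> A. c < b} = U - {c}"
      using c unfolding U_def by force
    then have "rank c = n"
      using a c U by (simp add: rank_def U_def)
    moreover have "c \<in> A" using c by (simp add: U_def)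
    ultimately show ?thesis by blast
  qed
  have "n \<in> rank ` A" for n
  proof -
    have "infinite (rank ` A)"
      using \<open>infinite A\<close> inj by (simp add: finite_image_iff)
    then obtain m where m: "m \<in> rank ` A" "n \<le> m"
      by (meson infinite_nat_iff_unbounded_le)
    show ?thesis
      using m(2,1) by (induction rule: inc_induct) (use pred in auto)
  qed
  then have rank: "bij_betw rank A UNIV"
    using inj by (auto simp: bij_betw_def)
  define r where "r = inv_into A rank"
  have r: "bij_betw r UNIV A"
    unfolding r_def using rank by (rule bij_betw_inv_into)
  have rr: "r n \<in> A" "rank (r n) = n" for n
    using rank by (auto simp: r_def bij_betw_def f_inv_into_f inv_into_into)
  have "r n < r m" if "m < n" for m n
    using anti[OF rr(1)[of m] rr(1)[of n]] rr(2) that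
    by (metis less_asym less_irrefl linorder_neqE_linordered_idom)
  with r show ?thesis by (rule that)
qed

text \<open>On the tail, the affine function \<open>s\<close> that defines a line is an affine function of \<open>r\<close>, so it is
  strictly monotone or constant. In the first case it changes its sign at most once and has at most
  one zero; in the second case no segment joins opposite sides and no point is the first one on the
  line after a point off it. The constant counts the \<open>m + 1\<close> segments up to index \<open>m\<close>, the last
  segment, one change of sign and one zero.\<close>

lemma vf_monotone_tail:
  assumes tail: "\<And>i. m \<le> i \<Longrightarrow> x i = of_real (r i) * e"
    and decreasing: "\<And>i j. m \<le> i \<Longrightarrow> i < j \<Longrightarrow> r j < r i"
  shows "vf (map x [0..<n]) \<le> m + 4"
proof (rule vf_le)
  fix a b
  let ?S = "map x [0..<n]"
  define s where "s i = a \<bullet> x i - b" for i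
  define Opp where "Opp = {i. m \<le> i \<and> (s i < 0 \<and> 0 < s (Suc i) \<or> s (Suc i) < 0 \<and> 0 < s i)}"
  \<comment> \<open>The inequality \<open>m < i\<close> is strict so that the predecessor of a zero lies on the tail, too.\<close>
  define Zero where "Zero = {i. m < i \<and> s i = 0 \<and> s (i - 1) \<noteq> 0}"
  have s: "s i = (a \<bullet> e) * r i - b" if "m \<le> i" for i
    using tail[OF that] by (simp add: s_def inner_complex_def algebra_simps)
  consider "\<And>i j. m \<le> i \<Longrightarrow> i < j \<Longrightarrow> s j < s i" | "\<And>i j. m \<le> i \<Longrightarrow> i < j \<Longrightarrow> s i < s j"
    | "\<And>i. m \<le> i \<Longrightarrow> s i = - b"
  proof (cases "a \<bullet> e" "0::real" rule: linorder_cases)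
    case less
    then show thesis using that(2) s decreasing by simp
  next
    case equal
    then show thesis using that(3) s by simp
  next
    case greater
    then show thesis using that(1) s decreasing by simp
  qed
  then have uniq: "i = j" if "i \<in> Opp \<and> j \<in> Opp \<or> i \<in> Zero \<and> j \<in> Zero" for i j
  proof cases
    case 1
    have "False" if "i \<in> Opp \<and> j \<in> Opp \<or> i \<in> Zero \<and> j \<in> Zero" "i < j" for i j
      using that 1[of i "Suc i"] 1[of j "Suc j"] 1[of "Suc i" j] 1[of i j]
      by (cases "Suc i = j") (auto simp: Opp_def Zero_def)
    from this[of i j] this[of j i] that show ?thesis by (meson linorder_neqE_nat)
  next
    case 2
    have "False" if "i \<in> Opp \<and> j \<in> Opp \<or> i \<in> Zero \<and> j \<in> Zero" "i < j" for i j
      using that 2[of i "Suc i"] 2[of j "Suc j"] 2[of "Suc i" j] 2[of i j]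
      by (cases "Suc i = j") (auto simp: Opp_def Zero_def)
    from this[of i j] this[of j i] that show ?thesis by (meson linorder_neqE_nat)
  next
    case 3
    with that show ?thesis by (fastforce simp: Opp_def Zero_def)
  qed
  have card_le_one: "finite X \<and> card X \<le> 1" if "\<And>i j. i \<in> X \<Longrightarrow> j \<in> X \<Longrightarrow> i = j" for X :: "nat set"
  proof (cases "X = {}")
    case False
    then obtain i where "i \<in> X" by blast
    then have "X = {i}" using that by blast
    then show ?thesis by simp
  qed simp
  have Opp: "finite Opp \<and> card Opp \<le> 1" and Zero: "finite Zero \<and> card Zero \<le> 1"
    using uniq by (blast intro!: card_le_one)+
  have "{i. Suc i < length ?S \<and> crossing_segment ?S a b i} \<subseteq> {..m} \<union> {n - 2} \<union> Opp \<union> Zero"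
  proof (rule subsetI, rule ccontr)
    fix i
    assume "i \<in> {i. Suc i < length ?S \<and> crossing_segment ?S a b i}"
      and out: "i \<notin> {..m} \<union> {n - 2} \<union> Opp \<union> Zero"
    then have i: "Suc i < length ?S" and cross: "crossing_segment ?S a b i"
      by auto
    have "?S ! i = x i" "?S ! Suc i = x (Suc i)" "?S ! (i - 1) = x (i - 1)"
      using i by (simp_all add: nth_map)
    with cross out show False
      by (auto simp: crossing_segment_def opposite_sides_def line_def Opp_def Zero_def s_def)
  qed
  then have "vf_on ?S a b \<le> card ({..m} \<union> {n - 2} \<union> Opp \<union> Zero)"
    unfolding vf_on_def using Opp Zero by (intro card_mono) auto
  also have "\<dots> \<le> card {..m} + card {n - 2} + card Opp + card Zero"
    using card_Un_le[of "{..m} \<union> {n - 2} \<union> Opp" Zero] card_Un_le[of "{..m} \<union> {n - 2}" Opp]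
      card_Un_le[of "{..m}" "{n - 2}"] by linarith
  also have "\<dots> \<le> m + 4"
    using Opp Zero by simp
  finally show "vf_on ?S a b \<le> m + 4" .
qed simp

text \<open>Here \<open>P\<close> consists of finitely many exceptional points that are enumerated before the points \<open>D\<close>
  of the ray, which follow in the order of decreasing norm. Beyond \<open>P\<close>, an initial segment of the
  enumeration consists of all points of \<open>\<sigma>\<close> on the ray whose norm exceeds some threshold. Hence it is
  cut out by a line and a half-plane, and the bounds do not depend on the length of the segment.\<close>

lemma ray_sequence:
  fixes \<sigma> P :: "complex set" and \<theta> :: real
  defines "D \<equiv> \<sigma> \<inter> ray \<theta> - {0}"
  assumes "infinite D" and "finite P" and "P \<inter> D = {}"
    and discrete: "\<And>\<epsilon>. 0 < \<epsilon> \<Longrightarrow> finite {z \<in> \<sigma>. \<epsilon> \<le> cmod z}"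
  obtains x :: "nat \<Rightarrow> complex" and C :: nat
  where "bij_betw x UNIV (P \<union> D)"
    and "\<And>n. switch_bound \<sigma> C (x ` {..n})"
    and "\<And>n. vf (map x [0..<n]) \<le> C"
proof -
  have D: "of_real (cmod z) * cis \<theta> = z" "0 < cmod z" if "z \<in> D" for z
    using that ray_polar[of z \<theta>] by (auto simp: D_def)
  have inj: "inj_on cmod D"
    using D(1) by (metis inj_onI)
  obtain r :: "nat \<Rightarrow> real" where r: "bij_betw r UNIV (cmod ` D)" and anti: "\<And>m n. m < n \<Longrightarrow> r n < r m"
  proof (rule decreasing_enumeration)
    show "infinite (cmod ` D)"
      using \<open>infinite D\<close> inj by (simp add: finite_image_iff)
    fix a assume "a \<in> cmod ` D"
    then have "finite (cmod ` {z \<in> \<sigma>. a \<le> cmod z})"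
      using D(2) discrete by blast
    then show "finite {b \<in> cmod ` D. a \<le> b}"
      by (rule rev_finite_subset) (auto simp: D_def)
  qed (use that in blast)
  define q where "q n = of_real (r n) * cis \<theta>" for n
  have r_mem: "r n \<in> cmod ` D" for n
    using r by (auto simp: bij_betw_def)
  have r_pos: "0 < r n" for n
    using r_mem[of n] D(2) by auto
  have norm_q: "cmod (q n) = r n" for n
    using r_pos[of n] by (simp add: q_def norm_mult)
  have q_mem: "q n \<in> D" for n
    using r_mem[of n] D(1) by (auto simp: q_def)
  have q: "bij_betw q UNIV D"
    unfolding bij_betw_def
  proof
    show "inj q"
      using norm_q r by (metis bij_betw_imp_inj_on inj_onI inj_onD)
    have "z \<in> range q" if "z \<in> D" for z
    proof -
      have "cmod z \<in> range r"
        using r that by (simp add: bij_betw_def)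
      then obtain n where n: "r n = cmod z"
        by auto
      have "z = q n"
        unfolding q_def n by (rule D(1)[OF that, symmetric])
      then show ?thesis by blast
    qed
    then show "range q = D"
      using q_mem by blast
  qed
  obtain p where p: "bij_betw p {..<card P} P"
    using \<open>finite P\<close> ex_bij_betw_nat_finite by (metis atLeast0LessThan)
  define m where "m = card P"
  define x where "x n = (if n < m then p n else q (n - m))" for n
  have x_bij: "bij_betw x UNIV (P \<union> D)"
  proof -
    have "bij_betw x {..<m} P"
      using p by (subst bij_betw_cong[of _ _ p]) (auto simp: x_def m_def)
    moreover have "bij_betw x {m..} D"
    proof -
      have "bij_betw (\<lambda>n. n - m) {m..} UNIV"
        by (rule bij_betw_byWitness[where f' = "\<lambda>n. n + m"]) auto
      then have "bij_betw (q \<circ> (\<lambda>n. n - m)) {m..} D"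
        using q by (rule bij_betw_trans)
      then show ?thesis
        by (subst bij_betw_cong[of _ _ "q \<circ> (\<lambda>n. n - m)"]) (auto simp: x_def)
    qed
    moreover have "{..<m} \<union> {m..} = UNIV" by auto
    ultimately show ?thesis
      using bij_betw_combine \<open>P \<inter> D = {}\<close> by metis
  qed
  have image: "switch_bound \<sigma> (4 * m + 3) (x ` {..n})" for n
  proof (cases "n < m")
    case True
    then have "x ` {..n} \<subseteq> P"
      using p by (auto simp: x_def m_def bij_betw_def)
    then have "finite (x ` {..n})" "card (x ` {..n}) \<le> m"
      using \<open>finite P\<close> by (auto simp: m_def intro: card_mono)
    then show ?thesis
      by (intro switch_bound_mono[OF switch_bound_finite]) auto
  next
    case False
    have pm: "p ` {..<m} = P"
      using p by (simp add: bij_betw_def m_def)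
    have "{..n} = {..<m} \<union> (\<lambda>i. i + m) ` {..n - m}"
    proof (intro set_eqI iffI)
      fix i assume "i \<in> {..n}"
      then show "i \<in> {..<m} \<union> (\<lambda>i. i + m) ` {..n - m}"
        using False by (cases "i < m") (auto intro!: image_eqI[of _ _ "i - m"])
    qed (use False in auto)
    then have "x ` {..n} = x ` {..<m} \<union> (\<lambda>i. x (i + m)) ` {..n - m}"
      by (simp add: image_Un image_image)
    also have "x ` {..<m} = P"
      using pm by (auto simp: x_def)
    also have "(\<lambda>i. x (i + m)) ` {..n - m} = q ` {..n - m}"
      by (simp add: x_def)
    finally have "x ` {..n} = P \<union> q ` {..n - m}" .
    \<comment> \<open>The threshold is the norm of the next point of the sequence.\<close>
    moreover have "q ` {..n - m} \<inter> \<sigma> = {z \<in> ray \<theta>. r (Suc (n - m)) < cmod z} \<inter> \<sigma>"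
    proof (intro set_eqI iffI)
      fix z assume "z \<in> q ` {..n - m} \<inter> \<sigma>"
      then show "z \<in> {z \<in> ray \<theta>. r (Suc (n - m)) < cmod z} \<inter> \<sigma>"
        using q_mem by (auto simp: norm_q D_def intro!: anti)
    next
      fix z assume z: "z \<in> {z \<in> ray \<theta>. r (Suc (n - m)) < cmod z} \<inter> \<sigma>"
      then have "z \<in> D"
        using r_pos[of "Suc (n - m)"] by (auto simp: D_def)
      then obtain i where i: "z = q i"
        using q by (auto simp: bij_betw_def)
      with z have "r (Suc (n - m)) < r i"
        by (simp add: norm_q)
      then have "i \<le> n - m"
        using anti[of "Suc (n - m)" i] by (cases i "Suc (n - m)" rule: linorder_cases) auto
      with i z show "z \<in> q ` {..n - m} \<inter> \<sigma>" by auto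
    qed
    then have "switch_bound \<sigma> 3 (q ` {..n - m})"
      using switch_bound_ray_segment[of "r (Suc (n - m))" \<sigma> \<theta>] r_pos[of "Suc (n - m)"]
      by (subst switch_bound_cong) auto
    moreover have "switch_bound \<sigma> (4 * m) P"
      unfolding m_def using \<open>finite P\<close> by (rule switch_bound_finite)
    ultimately show ?thesis
      using switch_bound_Un by metis
  qed
  have vf: "vf (map x [0..<n]) \<le> m + 4" for n
    by (rule vf_monotone_tail[of _ _ "\<lambda>i. r (i - m)" "cis \<theta>"])
      (auto simp: x_def q_def intro!: anti)
  show ?thesis
  proof (rule that[of x "4 * m + 4"])
    show "switch_bound \<sigma> (4 * m + 4) (x ` {..n})" for n
      by (rule switch_bound_mono[OF image]) simp
    show "vf (map x [0..<n]) \<le> 4 * m + 4" for n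
      using vf[of n] by simp
  qed (fact x_bij)
qed

section \<open>An equivalent norm\<close>

text \<open>The least such \<open>B\<close> is a norm that only sees the sequences; the variation along a sequence runs
  through its points in one fixed order. The limit point \<open>0\<close> enters through the supremum alone, because
  the jump from a sequence to \<open>0\<close> is at most twice the supremum.\<close>

definition seq_bounded ::
    "nat \<Rightarrow> (nat \<Rightarrow> nat \<Rightarrow> complex) \<Rightarrow> complex set \<Rightarrow> (complex \<Rightarrow> complex) \<Rightarrow> real \<Rightarrow> bool" where
  "seq_bounded k x \<sigma> f B \<longleftrightarrow> (\<forall>z\<in>\<sigma>. cmod (f z) \<le> B)
     \<and> (\<forall>j<k. \<forall>n. (\<Sum>i<n. cmod (f (x j (Suc i)) - f (x j i))) \<le> B)"

text \<open>The constant \<open>C\<close> carries the geometry: by the first bound, indicators of initial segments have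
  uniformly bounded variation; by the second one, a list that runs along a sequence contributes
  at least \<open>1 / C\<close> of the variation along it to the supremum in \<^const>\<open>bvar\<close>. The two directions of the norm equivalence rest on them.\<close>

definition ray_enumeration :: "nat \<Rightarrow> complex set \<Rightarrow> (nat \<Rightarrow> nat \<Rightarrow> complex) \<Rightarrow> bool" where
  "ray_enumeration k \<sigma> x \<longleftrightarrow> 0 \<in> \<sigma>
     \<and> bij_betw (\<lambda>(j, n). x j n) ({..<k} \<times> UNIV) (\<sigma> - {0})
     \<and> (\<exists>C. \<forall>j<k. \<forall>n. switch_bound \<sigma> C (x j ` {..n}) \<and> vf (map (x j) [0..<n]) \<le> C)"

text \<open>An infinite set of such points would accumulate away from \<open>0\<close>.\<close>

lemma C_set_discrete:
  assumes "C_set \<sigma>" and "0 < \<epsilon>"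
  shows "finite {z \<in> \<sigma>. \<epsilon> \<le> cmod z}"
proof (rule ccontr)
  let ?T = "{z \<in> \<sigma>. \<epsilon> \<le> cmod z}"
  assume "infinite ?T"
  have "?T = \<sigma> \<inter> - ball 0 \<epsilon>"
    by auto
  then have "compact ?T"
    using assms(1) compact_Int_closed[of \<sigma> "- ball 0 \<epsilon>"] by (simp add: C_set_def closed_def)
  with \<open>infinite ?T\<close> obtain x where x: "x \<in> ?T" "x islimpt ?T"
    by (auto simp: compact_eq_Bolzano_Weierstrass)
  then have "x islimpt \<sigma>"
    using islimpt_subset[of x ?T \<sigma>] by blast
  then have "x = 0"
    using assms(1) by (simp add: C_set_def)
  with x assms(2) show False by simp
qed

lemma C_set_zero_mem: "C_set \<sigma> \<Longrightarrow> 0 \<in> \<sigma>"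
  by (meson C_set_def closed_limpt compact_imp_closed)

text \<open>The finitely many points off the rays are put in front of the sequence along the first ray.\<close>

lemma ray_set_enumeration:
  assumes "ray_set k \<sigma>" and "k \<ge> 1"
  obtains x where "ray_enumeration k \<sigma> x"
proof -
  have C: "C_set \<sigma>"
    using assms by (simp add: ray_set_def)
  obtain \<theta> :: "nat \<Rightarrow> real" where inj: "inj_on (\<lambda>j. ray (\<theta> j)) {1..k}"
    and inf: "\<forall>j\<in>{1..k}. infinite (\<sigma> \<inter> ray (\<theta> j))"
    and fin: "finite (\<sigma> - (\<Union>j\<in>{1..k}. \<sigma> \<inter> ray (\<theta> j)))"
    using assms by (auto simp: ray_set_def)
  define D where "D j = \<sigma> \<inter> ray (\<theta> (Suc j)) - {0}" for j
  define P where "P j = (if j = 0 then \<sigma> - (\<Union>j\<in>{1..k}. \<sigma> \<inter> ray (\<theta> j)) else {})" for j :: nat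
  define E where "E j = P j \<union> D j" for j :: nat
  have P_disj: "P j \<inter> D i = {}" if "i < k" for i j
    using that by (auto simp: P_def D_def intro!: bexI[of _ "Suc i"])
  have D_disj: "D i \<inter> D j = {}" if "i < k" "j < k" "i \<noteq> j" for i j
  proof -
    have "ray (\<theta> (Suc i)) \<noteq> ray (\<theta> (Suc j))"
      using inj_on_eq_iff[OF inj, of "Suc i" "Suc j"] that by simp
    from ray_disjoint[OF this] show ?thesis unfolding D_def by blast
  qed
  have E_disj: "E i \<inter> E j = {}" if "i < k" "j < k" "i \<noteq> j" for i j
  proof -
    have "P i \<inter> P j = {}"
      using that(3) by (simp add: P_def)
    then show ?thesis
      using D_disj[OF that] P_disj[OF that(1), of j] P_disj[OF that(2), of i]
      unfolding E_def by blast
  qed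
  have "\<exists>x C. bij_betw x UNIV (E j) \<and> (\<forall>n. switch_bound \<sigma> C (x ` {..n}))
      \<and> (\<forall>n. vf (map x [0..<n]) \<le> C)" if "j < k" for j
  proof -
    have "infinite (D j)"
      using inf that by (simp add: D_def)
    moreover have "finite (P j)"
      using fin by (simp add: P_def)
    moreover have "P j \<inter> D j = {}"
      using P_disj[OF that] .
    ultimately obtain x C where "bij_betw x UNIV (P j \<union> D j)"
      "\<And>n. switch_bound \<sigma> C (x ` {..n})" "\<And>n. vf (map x [0..<n]) \<le> C"
      using ray_sequence[of \<sigma> "\<theta> (Suc j)" "P j", folded D_def] C_set_discrete[OF C] by blast
    then show ?thesis
      unfolding E_def by blast
  qed
  then obtain x C where x: "\<And>j. j < k \<Longrightarrow> bij_betw (x j) UNIV (E j)"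
      "\<And>j n. j < k \<Longrightarrow> switch_bound \<sigma> (C j) (x j ` {..n})"
      "\<And>j n. j < k \<Longrightarrow> vf (map (x j) [0..<n]) \<le> C j"
    by metis
  have 0: "0 \<in> \<sigma>"
    using C by (rule C_set_zero_mem)
  have zero_ray: "0 \<in> ray \<eta>" for \<eta>
    by (force simp: ray_def)
  have E_Union: "(\<Union>j<k. E j) = \<sigma> - {0}"
  proof (intro set_eqI iffI)
    fix z assume "z \<in> (\<Union>j<k. E j)"
    moreover have "P j \<subseteq> \<sigma> - {0}" for j
      using 0 zero_ray assms(2) by (auto simp: P_def intro!: bexI[of _ 1])
    ultimately show "z \<in> \<sigma> - {0}"
      unfolding E_def D_def by blast
  next
    fix z assume z: "z \<in> \<sigma> - {0}"
    show "z \<in> (\<Union>j<k. E j)"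
    proof (cases "z \<in> P 0")
      case True
      then show ?thesis using assms(2) by (auto simp: E_def intro!: bexI[of _ 0])
    next
      case False
      then obtain j where "j \<in> {1..k}" "z \<in> ray (\<theta> j)"
        using z by (auto simp: P_def)
      then show ?thesis
        using z by (auto simp: E_def D_def intro!: bexI[of _ "j - 1"])
    qed
  qed
  have "bij_betw (\<lambda>(j, n). x j n) ({..<k} \<times> UNIV) (\<sigma> - {0})"
    unfolding bij_betw_def
  proof
    show "inj_on (\<lambda>(j, n). x j n) ({..<k} \<times> UNIV)"
    proof (rule inj_onI, clarsimp)
      fix i m j n assume *: "i < k" "j < k" "x i m = x j n"
      have "x i m \<in> E i" "x j n \<in> E j"
        using bij_betwE[OF x(1)[OF *(1)]] bij_betwE[OF x(1)[OF *(2)]] by blast+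
      then have "i = j"
        using E_disj[of i j] * by auto
      then show "i = j \<and> m = n"
        using x(1)[of j] * by (auto simp: bij_betw_def inj_def)
    qed
    have "(\<lambda>(j, n). x j n) ` ({..<k} \<times> UNIV) = (\<Union>j<k. range (x j))"
      by force
    also have "\<dots> = \<sigma> - {0}"
      using x(1) E_Union by (simp add: bij_betw_def)
    finally show "(\<lambda>(j, n). x j n) ` ({..<k} \<times> UNIV) = \<sigma> - {0}" .
  qed
  moreover have "switch_bound \<sigma> (\<Sum>j<k. C j) (x j ` {..n}) \<and> vf (map (x j) [0..<n]) \<le> (\<Sum>j<k. C j)"
    if "j < k" for j n
  proof -
    have "C j \<le> (\<Sum>j<k. C j)"
      using that by (intro member_le_sum) auto
    then show ?thesis
      using x(2,3)[OF that, of n] switch_bound_mono order_trans by blast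
  qed
  ultimately have "ray_enumeration k \<sigma> x"
    using 0 unfolding ray_enumeration_def by blast
  then show thesis by (rule that)
qed

lemma cvar_cong:
  assumes "\<And>z. z \<in> set S \<Longrightarrow> f z = g z"
  shows "cvar f S = cvar g S"
  unfolding cvar_def by (intro sum.cong) (auto simp: assms)

lemma cvar_add_le: "cvar (\<lambda>z. f z + g z) S \<le> cvar f S + cvar g S"
  unfolding cvar_def sum.distrib[symmetric]
  by (intro sum_mono) (metis add_diff_add norm_triangle_ineq)

lemma cvar_sum_le: "cvar (\<lambda>z. \<Sum>t\<in>T. f t z) S \<le> (\<Sum>t\<in>T. cvar (f t) S)"
proof (induction T rule: infinite_finite_induct)
  case (insert t T)
  have "cvar (\<lambda>z. \<Sum>t\<in>insert t T. f t z) S = cvar (\<lambda>z. f t z + (\<Sum>t\<in>T. f t z)) S"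
    using insert by simp
  also have "\<dots> \<le> cvar (f t) S + cvar (\<lambda>z. \<Sum>t\<in>T. f t z) S"
    by (rule cvar_add_le)
  also have "\<dots> \<le> cvar (f t) S + (\<Sum>t\<in>T. cvar (f t) S)"
    using insert by simp
  finally show ?case using insert by simp
qed (simp_all add: cvar_def)

lemma cvar_indicator: "cvar (\<lambda>z. c * of_bool (z \<in> A)) S = cmod c * real (switches A S)"
proof -
  have "cvar (\<lambda>z. c * of_bool (z \<in> A)) S
      = (\<Sum>i<length S - 1. cmod (c * of_bool (S ! Suc i \<in> A) - c * of_bool (S ! i \<in> A)))"
    unfolding cvar_def
    by (rule sum.reindex_bij_witness[of _ Suc "\<lambda>i. i - 1"]) auto
  also have "\<dots> = (\<Sum>i<length S - 1. if (S ! i \<in> A) \<noteq> (S ! Suc i \<in> A) then cmod c else 0)"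
    by (intro sum.cong) auto
  also have "\<dots> = cmod c * real (card ({..<length S - 1} \<inter> {i. (S ! i \<in> A) \<noteq> (S ! Suc i \<in> A)}))"
    by (simp add: sum.If_cases)
  also have "{..<length S - 1} \<inter> {i. (S ! i \<in> A) \<noteq> (S ! Suc i \<in> A)}
      = {i. Suc i < length S \<and> (S ! i \<in> A) \<noteq> (S ! Suc i \<in> A)}"
    by auto
  finally show ?thesis by (simp add: switches_def)
qed

lemma cvar_indicator_le:
  assumes "switch_bound \<sigma> C A" and "S \<noteq> []" and "set S \<subseteq> \<sigma>"
  shows "cvar (\<lambda>z. c * of_bool (z \<in> A)) S \<le> cmod c * (C * vf S)"
proof -
  have "switches A S \<le> C * vf S"
    using assms by (simp add: switch_bound_def)
  then have "real (switches A S) \<le> C * vf S"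
    using of_nat_le_iff by blast
  then show ?thesis
    unfolding cvar_indicator by (intro mult_left_mono) auto
qed

lemma cvar_map_upt:
  "cvar f (map x [0..<Suc n]) = (\<Sum>i<n. cmod (f (x (Suc i)) - f (x i)))"
  unfolding cvar_def
  by (rule sum.reindex_bij_witness[of _ Suc "\<lambda>i. i - 1"]) (auto simp del: upt_Suc)

lemma ray_enumeration_mem:
  assumes "ray_enumeration k \<sigma> x" and "j < k"
  shows "x j n \<in> \<sigma>" and "x j n \<noteq> 0"
proof -
  have "bij_betw (\<lambda>(j, n). x j n) ({..<k} \<times> UNIV) (\<sigma> - {0})"
    using assms(1) by (simp add: ray_enumeration_def)
  then have "(\<lambda>(j, n). x j n) (j, n) \<in> \<sigma> - {0}"
    using assms(2) bij_betwE by blast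
  then show "x j n \<in> \<sigma>" "x j n \<noteq> 0" by auto
qed

lemma ray_enumeration_eq_iff:
  assumes "ray_enumeration k \<sigma> x" and "i < k" and "j < k"
  shows "x i m = x j n \<longleftrightarrow> i = j \<and> m = n"
proof -
  have "inj_on (\<lambda>(j, n). x j n) ({..<k} \<times> UNIV)"
    using assms by (auto simp: ray_enumeration_def bij_betw_def)
  from inj_on_eq_iff[OF this, of "(i, m)" "(j, n)"] assms show ?thesis by simp
qed

lemma ray_enumeration_cases:
  assumes "ray_enumeration k \<sigma> x" and "z \<in> \<sigma>"
  obtains "z = 0" | j n where "j < k" and "z = x j n"
proof (cases "z = 0")
  case False
  then have "z \<in> (\<lambda>(j, n). x j n) ` ({..<k} \<times> UNIV)"
    using assms by (auto simp: ray_enumeration_def bij_betw_def)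
  then show ?thesis using that(2) by auto
qed (rule that(1))

text \<open>On a finite list, \<open>f\<close> is a combination of the indicators of \<open>{0}\<close> and of the initial segments of
  the sequences; summation by parts gives the coefficients. The coefficients at \<open>{0}\<close> and at the
  longest segments are values of \<open>f\<close>, all the others are increments of \<open>f\<close> along a sequence, and every
  indicator costs at most a fixed multiple of the variation factor.\<close>

lemma bv_enorm_le:
  assumes enum: "ray_enumeration k \<sigma> x"
  obtains K where "0 \<le> K" and "\<And>f B. seq_bounded k x \<sigma> f B \<Longrightarrow> bv_enorm \<sigma> f \<le> ennreal (K * B)"
proof -
  obtain C0 where C0: "\<And>j n. j < k \<Longrightarrow> switch_bound \<sigma> C0 (x j ` {..n})"
    using enum by (auto simp: ray_enumeration_def)
  define C where "C = C0 + 4"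
  have C: "switch_bound \<sigma> C (x j ` {..n})" if "j < k" for j n
    using C0[OF that] by (rule switch_bound_mono) (simp add: C_def)
  have C_zero: "switch_bound \<sigma> C {0}"
    using switch_bound_singleton by (rule switch_bound_mono) (simp add: C_def)
  have "bv_enorm \<sigma> f \<le> ennreal ((1 + C * (1 + 2 * k)) * B)" if f: "seq_bounded k x \<sigma> f B" for f and B :: real
  proof -
    have f_le: "cmod (f z) \<le> B" if "z \<in> \<sigma>" for z
      using f that by (simp add: seq_bounded_def)
    have f_var: "(\<Sum>i<n. cmod (f (x j (Suc i)) - f (x j i))) \<le> B" if "j < k" for j n
      using f that by (simp add: seq_bounded_def)
    have zero: "0 \<in> \<sigma>"
      using enum by (simp add: ray_enumeration_def)
    have B: "0 \<le> B"
      using f_le[OF zero] norm_ge_zero order_trans by blast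
    have cvar_le: "cvar f S \<le> C * (1 + 2 * k) * B * vf S" if S: "S \<noteq> []" "set S \<subseteq> \<sigma>" for S
    proof -
      have "\<exists>N. \<forall>n. (\<exists>j<k. x j n \<in> set S) \<longrightarrow> n \<le> N"
      proof -
        have "finite {n. x j n \<in> set S}" if "j < k" for j
        proof -
          have "inj (x j)"
            using ray_enumeration_eq_iff[OF enum that that] by (auto simp: inj_def)
          then have "finite (x j -` set S)"
            by (intro finite_vimageI) auto
          then show ?thesis by (simp add: vimage_def)
        qed
        then have "finite (\<Union>j<k. {n. x j n \<in> set S})"
          by auto
        then show ?thesis
          by (auto simp: finite_nat_set_iff_bounded_le)
      qed
      then obtain N where N: "\<And>j n. j < k \<Longrightarrow> x j n \<in> set S \<Longrightarrow> n \<le> N"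
        by blast
      \<comment> \<open>All points of the list have an index of at most \<open>N\<close> in their sequences, so the sums over the
        coefficients from \<open>n\<close> to \<open>N\<close> telescope to the value of \<open>f\<close> at the point of index \<open>n\<close>.\<close>
      define c where "c j i = (if i < N then f (x j i) - f (x j (Suc i)) else f (x j N))" for j i
      define g where "g z = f 0 * of_bool (z \<in> {0})
          + (\<Sum>j<k. \<Sum>i\<le>N. c j i * of_bool (z \<in> x j ` {..i}))" for z
      have "f z = g z" if "z \<in> set S" for z
      proof -
        from that S have "z \<in> \<sigma>" by auto
        with enum show ?thesis
        proof (cases rule: ray_enumeration_cases)
          case 1
          have "z \<notin> x j ` {..i}" if "j < k" for j i
            using ray_enumeration_mem(2)[OF enum that] 1 by auto
          then show ?thesis
            by (simp add: g_def 1)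
        next
          case (2 j n)
          have n: "n \<le> N"
            using N 2 that by simp
          have mem: "z \<in> x i ` {..m} \<longleftrightarrow> i = j \<and> n \<le> m" if "i < k" for i m
            using ray_enumeration_eq_iff[OF enum \<open>j < k\<close> that] 2 by auto
          have telescope: "(\<Sum>i = n..N. c j i) = f (x j n)"
          proof -
            have "(\<Sum>i = n..N. c j i) = (\<Sum>i = n..<N. f (x j i) - f (x j (Suc i))) + f (x j N)"
              using n by (simp add: atLeastLessThanSuc_atLeastAtMost[symmetric] c_def)
            also have "(\<Sum>i = n..<N. f (x j i) - f (x j (Suc i))) = f (x j n) - f (x j N)"
              using sum_Suc_diff'[OF n, of "\<lambda>i. - f (x j i)"] by simp
            finally show ?thesis by simp
          qed
          have "(\<Sum>i<k. \<Sum>m\<le>N. c i m * of_bool (z \<in> x i ` {..m}))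
              = (\<Sum>i<k. if i = j then \<Sum>m\<le>N. c j m * of_bool (n \<le> m) else 0)"
            by (intro sum.cong) (auto simp: mem)
          also have "\<dots> = (\<Sum>m\<le>N. c j m * of_bool (n \<le> m))"
            using \<open>j < k\<close> by simp
          also have "\<dots> = (\<Sum>m\<in>{n..N}. c j m)"
            by (intro sum.mono_neutral_cong_right) auto
          finally show ?thesis
            using 2 ray_enumeration_mem(2)[OF enum \<open>j < k\<close>, of n] by (simp add: g_def telescope)
        qed
      qed
      then have "cvar f S = cvar g S"
        by (rule cvar_cong)
      also have "\<dots> \<le> cvar (\<lambda>z. f 0 * of_bool (z \<in> {0})) S
          + cvar (\<lambda>z. \<Sum>j<k. \<Sum>i\<le>N. c j i * of_bool (z \<in> x j ` {..i})) S"
        unfolding g_def by (rule cvar_add_le)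
      also have "cvar (\<lambda>z. f 0 * of_bool (z \<in> {0})) S \<le> B * (C * vf S)"
        by (rule order_trans[OF cvar_indicator_le[OF C_zero S]])
          (intro mult_right_mono f_le zero, simp)
      also have "cvar (\<lambda>z. \<Sum>j<k. \<Sum>i\<le>N. c j i * of_bool (z \<in> x j ` {..i})) S
          \<le> (\<Sum>j<k. 2 * B * (C * vf S))"
      proof (rule order_trans[OF cvar_sum_le], rule sum_mono)
        fix j assume "j \<in> {..<k}"
        then have j: "j < k" by simp
        have "cvar (\<lambda>z. \<Sum>i\<le>N. c j i * of_bool (z \<in> x j ` {..i})) S
            \<le> (\<Sum>i\<le>N. cmod (c j i) * (C * vf S))"
          by (rule order_trans[OF cvar_sum_le]) (intro sum_mono cvar_indicator_le[OF C[OF j] S])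
        also have "\<dots> = (\<Sum>i\<le>N. cmod (c j i)) * (C * vf S)"
          by (simp add: sum_distrib_right)
        also have "(\<Sum>i\<le>N. cmod (c j i)) = (\<Sum>i<N. cmod (c j i)) + cmod (c j N)"
          by (simp flip: lessThan_Suc_atMost)
        also have "(\<Sum>i<N. cmod (c j i)) = (\<Sum>i<N. cmod (f (x j (Suc i)) - f (x j i)))"
          by (intro sum.cong) (auto simp: c_def norm_minus_commute)
        also have "((\<Sum>i<N. cmod (f (x j (Suc i)) - f (x j i))) + cmod (c j N)) * (C * vf S)
            \<le> (B + B) * (C * vf S)"
          using f_var[OF j, of N] f_le[OF ray_enumeration_mem(1)[OF enum j], of N]
          by (intro mult_right_mono add_mono) (auto simp: c_def)
        finally show "cvar (\<lambda>z. \<Sum>i\<le>N. c j i * of_bool (z \<in> x j ` {..i})) S \<le> 2 * B * (C * vf S)"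
          by simp
      qed
      finally show ?thesis
        by (simp add: algebra_simps)
    qed
    have "ennreal (cvar f S / vf S) \<le> ennreal (C * (1 + 2 * k) * B)" if "S \<noteq> []" "set S \<subseteq> \<sigma>" for S
      using cvar_le[OF that] vf_pos[OF that(1)] by (intro ennreal_leI) (simp add: divide_le_eq)
    then have "bvar \<sigma> f \<le> ennreal (C * (1 + 2 * k) * B)"
      unfolding bvar_def by (intro SUP_least) auto
    moreover have "(SUP z\<in>\<sigma>. ennreal (cmod (f z))) \<le> ennreal B"
      by (intro SUP_least ennreal_leI f_le)
    ultimately have "bv_enorm \<sigma> f \<le> ennreal B + ennreal (C * (1 + 2 * k) * B)"
      unfolding bv_enorm_def by (rule add_mono[rotated])
    also have "\<dots> = ennreal ((1 + C * (1 + 2 * k)) * B)"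
      using B by (simp add: algebra_simps flip: ennreal_plus)
    finally show ?thesis .
  qed
  then show thesis
    by (intro that[of "real (1 + C * (1 + 2 * k))"]) auto
qed

text \<open>The supremum is tested on the lists of the first points of a sequence, whose variation factors
  are bounded.\<close>

lemma seq_bounded_of_bv_enorm_le:
  assumes enum: "ray_enumeration k \<sigma> x"
  obtains K where "0 \<le> K"
    and "\<And>f B. 0 \<le> B \<Longrightarrow> bv_enorm \<sigma> f \<le> ennreal B \<Longrightarrow> seq_bounded k x \<sigma> f (K * B)"
proof -
  obtain C where C: "\<And>j n. j < k \<Longrightarrow> vf (map (x j) [0..<n]) \<le> C"
    using enum by (auto simp: ray_enumeration_def)
  have "seq_bounded k x \<sigma> f (real (C + 1) * B)" if "0 \<le> B" and f: "bv_enorm \<sigma> f \<le> ennreal B" for f B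
    unfolding seq_bounded_def
  proof (intro conjI ballI allI impI)
    fix z assume "z \<in> \<sigma>"
    then have "ennreal (cmod (f z)) \<le> (SUP z\<in>\<sigma>. ennreal (cmod (f z)))"
      by (rule SUP_upper)
    also have "\<dots> \<le> bv_enorm \<sigma> f"
      by (simp add: bv_enorm_def)
    also note f
    finally have "cmod (f z) \<le> B"
      using \<open>0 \<le> B\<close> by simp
    also have "B \<le> real (C + 1) * B"
      using \<open>0 \<le> B\<close> by (simp add: algebra_simps)
    finally show "cmod (f z) \<le> real (C + 1) * B" .
  next
    fix j n assume j: "j < k"
    define S where "S = map (x j) [0..<Suc n]"
    have S: "S \<noteq> []" "set S \<subseteq> \<sigma>"
      using ray_enumeration_mem(1)[OF enum j] by (auto simp: S_def)
    then have "ennreal (cvar f S / vf S) \<le> bvar \<sigma> f"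
      unfolding bvar_def by (intro SUP_upper) auto
    also have "\<dots> \<le> bv_enorm \<sigma> f"
      by (simp add: bv_enorm_def)
    also note f
    finally have "cvar f S / vf S \<le> B"
      using \<open>0 \<le> B\<close> by simp
    then have "cvar f S \<le> B * vf S"
      using vf_pos[OF S(1)] by (simp add: divide_le_eq)
    also have "\<dots> \<le> B * real (C + 1)"
      using C[OF j, of "Suc n"] \<open>0 \<le> B\<close> by (intro mult_left_mono) (auto simp: S_def simp del: upt_Suc)
    finally show "(\<Sum>i<n. cmod (f (x j (Suc i)) - f (x j i))) \<le> real (C + 1) * B"
      unfolding S_def cvar_map_upt by (simp add: mult.commute)
  qed
  then show thesis
    by (intro that[of "real (C + 1)"]) auto
qed

text \<open>Membership in \<^term>\<open>BV \<sigma>\<close> thus forgets the position of the points and depends only on the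
  enumeration.\<close>

lemma BV_iff_seq_bounded:
  assumes enum: "ray_enumeration k \<sigma> x"
  shows "f \<in> BV \<sigma> \<longleftrightarrow> (\<forall>z. z \<notin> \<sigma> \<longrightarrow> f z = 0) \<and> (\<exists>B. seq_bounded k x \<sigma> f B)"
proof -
  have "bv_enorm \<sigma> f < \<infinity> \<longleftrightarrow> (\<exists>B. seq_bounded k x \<sigma> f B)"
  proof
    assume "bv_enorm \<sigma> f < \<infinity>"
    then have "bv_enorm \<sigma> f \<le> ennreal (enn2real (bv_enorm \<sigma> f))"
      by (simp add: less_top)
    then show "\<exists>B. seq_bounded k x \<sigma> f B"
      using seq_bounded_of_bv_enorm_le[OF enum] enn2real_nonneg by metis
  next
    assume "\<exists>B. seq_bounded k x \<sigma> f B"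
    then obtain B where "seq_bounded k x \<sigma> f B" by blast
    then obtain K where "bv_enorm \<sigma> f \<le> ennreal (K * B)"
      using bv_enorm_le[OF enum] by metis
    then show "bv_enorm \<sigma> f < \<infinity>"
      using ennreal_less_top le_less_trans infinity_ennreal_def by metis
  qed
  then show ?thesis by (simp add: BV_def)
qed

section \<open>Equal numbers of rays\<close>

text \<open>Functions in \<^term>\<open>BV \<tau>\<close> vanish off \<open>\<tau>\<close>, so composition with \<open>g\<close> is truncated there.\<close>

definition pullback :: "complex set \<Rightarrow> (complex \<Rightarrow> complex) \<Rightarrow> (complex \<Rightarrow> complex) \<Rightarrow> complex \<Rightarrow> complex" where
  "pullback \<tau> g f w = (if w \<in> \<tau> then f (g w) else 0)"

lemma BV_bv_enorm: "f \<in> BV \<sigma> \<Longrightarrow> bv_enorm \<sigma> f = ennreal (bv_norm \<sigma> f)"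
  by (simp add: BV_def bv_norm_def less_top)

lemma pullback_mem_BV:
  assumes lip: "\<And>f B. 0 \<le> B \<Longrightarrow> bv_enorm \<sigma> f \<le> ennreal B \<Longrightarrow> bv_enorm \<tau> (pullback \<tau> g f) \<le> ennreal (L * B)"
    and f: "f \<in> BV \<sigma>"
  shows "pullback \<tau> g f \<in> BV \<tau>" and "bv_norm \<tau> (pullback \<tau> g f) \<le> \<bar>L\<bar> * bv_norm \<sigma> f"
proof -
  have nonneg: "0 \<le> bv_norm \<sigma> f"
    by (simp add: bv_norm_def)
  have le: "bv_enorm \<tau> (pullback \<tau> g f) \<le> ennreal (L * bv_norm \<sigma> f)"
    using BV_bv_enorm[OF f] nonneg by (intro lip) auto
  also have "\<dots> < \<infinity>" by simp
  finally show "pullback \<tau> g f \<in> BV \<tau>"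
    by (auto simp: BV_def pullback_def)
  have "bv_enorm \<tau> (pullback \<tau> g f) \<le> ennreal (\<bar>L\<bar> * bv_norm \<sigma> f)"
    by (rule order_trans[OF le]) (intro ennreal_leI mult_right_mono nonneg, simp)
  then have "enn2real (bv_enorm \<tau> (pullback \<tau> g f)) \<le> \<bar>L\<bar> * bv_norm \<sigma> f"
    using nonneg by (intro enn2real_leI) auto
  then show "bv_norm \<tau> (pullback \<tau> g f) \<le> \<bar>L\<bar> * bv_norm \<sigma> f"
    by (simp add: bv_norm_def)
qed

lemma continuous_map_pullback:
  assumes lip: "\<And>f B. 0 \<le> B \<Longrightarrow> bv_enorm \<sigma> f \<le> ennreal B \<Longrightarrow> bv_enorm \<tau> (pullback \<tau> g f) \<le> ennreal (L * B)"
  shows "continuous_map (bv_topology \<sigma>) (bv_topology \<tau>) (pullback \<tau> g)"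
proof -
  have "bv_dist \<tau> (pullback \<tau> g f1) (pullback \<tau> g f2) \<le> \<bar>L\<bar> * bv_dist \<sigma> f1 f2"
    if "f1 \<in> BV \<sigma>" "f2 \<in> BV \<sigma>" for f1 f2
  proof -
    have "(\<lambda>w. pullback \<tau> g f1 w - pullback \<tau> g f2 w) = pullback \<tau> g (\<lambda>z. f1 z - f2 z)"
      by (auto simp: pullback_def)
    then show ?thesis
      using pullback_mem_BV(2)[OF lip BV_diff[OF that]] by (simp add: bv_dist_def)
  qed
  then have "Lipschitz_continuous_map (metric (BV \<sigma>, bv_dist \<sigma>)) (metric (BV \<tau>, bv_dist \<tau>)) (pullback \<tau> g)"
    using pullback_mem_BV(1)[OF lip] unfolding Lipschitz_continuous_map_def
    by (auto simp: Metric_space.mspace_metric[OF Metric_space_BV]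
        Metric_space.mdist_metric[OF Metric_space_BV])
  from Lipschitz_continuous_imp_continuous_map[OF this] show ?thesis
    by (simp add: bv_topology_def Metric_space.mtopology_of[OF Metric_space_BV])
qed

text \<open>Composition respects all pointwise operations; the two estimates say that it is bounded in both
  directions.\<close>

lemma BV_isomorphic_pullback:
  assumes g: "\<And>w. w \<in> \<tau> \<Longrightarrow> g w \<in> \<sigma> \<and> h (g w) = w"
    and h: "\<And>z. z \<in> \<sigma> \<Longrightarrow> h z \<in> \<tau> \<and> g (h z) = z"
    and lip_g: "\<And>f B. 0 \<le> B \<Longrightarrow> bv_enorm \<sigma> f \<le> ennreal B \<Longrightarrow> bv_enorm \<tau> (pullback \<tau> g f) \<le> ennreal (L * B)"
    and lip_h: "\<And>f B. 0 \<le> B \<Longrightarrow> bv_enorm \<tau> f \<le> ennreal B \<Longrightarrow> bv_enorm \<sigma> (pullback \<sigma> h f) \<le> ennreal (M * B)"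
  shows "BV_isomorphic \<sigma> \<tau>"
proof -
  let ?\<Phi> = "pullback \<tau> g" and ?\<Psi> = "pullback \<sigma> h"
  have \<Psi>\<Phi>: "?\<Psi> (?\<Phi> f) = f" if "f \<in> BV \<sigma>" for f
    using that g h by (auto simp: pullback_def BV_def fun_eq_iff)
  have \<Phi>\<Psi>: "?\<Phi> (?\<Psi> f) = f" if "f \<in> BV \<tau>" for f
    using that g h by (auto simp: pullback_def BV_def fun_eq_iff)
  have bij: "bij_betw ?\<Phi> (BV \<sigma>) (BV \<tau>)"
    by (rule bij_betw_byWitness[where f' = ?\<Psi>])
      (use \<Psi>\<Phi> \<Phi>\<Psi> pullback_mem_BV(1)[OF lip_g] pullback_mem_BV(1)[OF lip_h] in auto)
  have inv: "inv_into (BV \<sigma>) ?\<Phi> f = ?\<Psi> f" if "f \<in> BV \<tau>" for f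
    using bij that \<Phi>\<Psi> pullback_mem_BV(1)[OF lip_h that]
    by (intro inv_into_f_eq) (auto simp: bij_betw_def)
  have "topspace (bv_topology \<tau>) = BV \<tau>"
    by (simp add: bv_topology_def Metric_space.topspace_mtopology[OF Metric_space_BV])
  then have "continuous_map (bv_topology \<tau>) (bv_topology \<sigma>) (inv_into (BV \<sigma>) ?\<Phi>)"
    using inv by (intro continuous_map_eq[OF continuous_map_pullback[OF lip_h]]) auto
  then show ?thesis
    unfolding BV_isomorphic_def using bij continuous_map_pullback[OF lip_g]
    by (intro exI[of _ ?\<Phi>]) (auto simp: pullback_def)
qed

lemma ray_enumeration_matching:
  assumes "ray_enumeration k \<sigma> x"
  obtains g where "g 0 = (0::complex)" and "\<And>j n. j < k \<Longrightarrow> g (x j n) = y j n"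
proof -
  define pos where "pos = inv_into ({..<k} \<times> UNIV) (\<lambda>(j, n). x j n)"
  have pos: "pos (x j n) = (j, n)" if "j < k" for j n
  proof -
    have "inj_on (\<lambda>(j, n). x j n) ({..<k} \<times> UNIV)"
      using assms by (simp add: ray_enumeration_def bij_betw_def)
    from inv_into_f_f[OF this, of "(j, n)"] that show ?thesis
      by (simp add: pos_def)
  qed
  define g where "g w = (if w = 0 then 0 else y (fst (pos w)) (snd (pos w)))" for w
  show thesis
    by (rule that[of g]) (use pos ray_enumeration_mem(2)[OF assms] in \<open>auto simp: g_def\<close>)
qed

text \<open>Composition with \<open>g\<close> leaves \<^const>\<open>seq_bounded\<close> unchanged, and this is an equivalent norm on
  both sides.\<close>

lemma pullback_lipschitz:
  assumes \<sigma>: "ray_enumeration k \<sigma> x" and \<tau>: "ray_enumeration k \<tau> y"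
    and g0: "g 0 = 0" and g: "\<And>j n. j < k \<Longrightarrow> g (y j n) = x j n"
  obtains L where "\<And>f B. 0 \<le> B \<Longrightarrow> bv_enorm \<sigma> f \<le> ennreal B \<Longrightarrow>
    bv_enorm \<tau> (pullback \<tau> g f) \<le> ennreal (L * B)"
proof -
  obtain K where K: "\<And>f B. 0 \<le> B \<Longrightarrow> bv_enorm \<sigma> f \<le> ennreal B \<Longrightarrow> seq_bounded k x \<sigma> f (K * B)"
    using seq_bounded_of_bv_enorm_le[OF \<sigma>] by metis
  obtain K' where K': "\<And>f B. seq_bounded k y \<tau> f B \<Longrightarrow> bv_enorm \<tau> f \<le> ennreal (K' * B)"
    using bv_enorm_le[OF \<tau>] by metis
  have g_mem: "g w \<in> \<sigma>" if "w \<in> \<tau>" for w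
    using \<tau> that
  proof (cases rule: ray_enumeration_cases)
    case 1
    then show ?thesis using g0 \<sigma> by (simp add: ray_enumeration_def)
  next
    case (2 j n)
    then show ?thesis using g ray_enumeration_mem(1)[OF \<sigma>] by simp
  qed
  have "seq_bounded k y \<tau> (pullback \<tau> g f) B" if "seq_bounded k x \<sigma> f B" for f B
    using that g g_mem ray_enumeration_mem(1)[OF \<tau>] by (simp add: seq_bounded_def pullback_def)
  then have "bv_enorm \<tau> (pullback \<tau> g f) \<le> ennreal ((K' * K) * B)"
    if "0 \<le> B" "bv_enorm \<sigma> f \<le> ennreal B" for f B
    using K'[of _ "K * B"] K[OF that] by (simp add: mult.assoc)
  then show thesis by (rule that)
qed

lemma BV_isomorphic_same_rays:
  assumes \<sigma>: "ray_enumeration k \<sigma> x" and \<tau>: "ray_enumeration k \<tau> y"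
  shows "BV_isomorphic \<sigma> \<tau>"
proof -
  obtain g where g: "g 0 = 0" "\<And>j n. j < k \<Longrightarrow> g (y j n) = x j n"
    using ray_enumeration_matching[OF \<tau>] by metis
  obtain h where h: "h 0 = 0" "\<And>j n. j < k \<Longrightarrow> h (x j n) = y j n"
    using ray_enumeration_matching[OF \<sigma>] by metis
  obtain L where L: "\<And>f B. 0 \<le> B \<Longrightarrow> bv_enorm \<sigma> f \<le> ennreal B \<Longrightarrow>
      bv_enorm \<tau> (pullback \<tau> g f) \<le> ennreal (L * B)"
    using pullback_lipschitz[OF \<sigma> \<tau> g] by metis
  obtain M where M: "\<And>f B. 0 \<le> B \<Longrightarrow> bv_enorm \<tau> f \<le> ennreal B \<Longrightarrow>
      bv_enorm \<sigma> (pullback \<sigma> h f) \<le> ennreal (M * B)"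
    using pullback_lipschitz[OF \<tau> \<sigma> h] by metis
  have gh: "g w \<in> \<sigma> \<and> h (g w) = w" if "w \<in> \<tau>" for w
    using \<tau> that
  proof (cases rule: ray_enumeration_cases)
    case 1
    then show ?thesis using g h \<sigma> by (simp add: ray_enumeration_def)
  next
    case (2 j n)
    then show ?thesis using g h ray_enumeration_mem(1)[OF \<sigma>] by simp
  qed
  have hg: "h z \<in> \<tau> \<and> g (h z) = z" if "z \<in> \<sigma>" for z
    using \<sigma> that
  proof (cases rule: ray_enumeration_cases)
    case 1
    then show ?thesis using g h \<tau> by (simp add: ray_enumeration_def)
  next
    case (2 j n)
    then show ?thesis using g h ray_enumeration_mem(1)[OF \<tau>] by simp
  qed
  show ?thesis
    using gh hg L M by (rule BV_isomorphic_pullback)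
qed

section \<open>Counting the rays\<close>

text \<open>Closure under products is what makes the inverse of a multiplicative bijection multiplicative.\<close>

lemma BV_mult:
  assumes enum: "ray_enumeration k \<sigma> x" and "f \<in> BV \<sigma>" and "g \<in> BV \<sigma>"
  shows "(\<lambda>z. f z * g z) \<in> BV \<sigma>"
proof -
  obtain A where A: "seq_bounded k x \<sigma> f A"
    using assms(2) BV_iff_seq_bounded[OF enum] by blast
  obtain B where B: "seq_bounded k x \<sigma> g B"
    using assms(3) BV_iff_seq_bounded[OF enum] by blast
  have zero: "0 \<in> \<sigma>"
    using enum by (simp add: ray_enumeration_def)
  have fA: "cmod (f z) \<le> A" and gB: "cmod (g z) \<le> B" if "z \<in> \<sigma>" for z
    using A B that by (auto simp: seq_bounded_def)
  have nonneg: "0 \<le> A" "0 \<le> B"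
    using fA[OF zero] gB[OF zero] norm_ge_zero order_trans by blast+
  have "seq_bounded k x \<sigma> (\<lambda>z. f z * g z) (2 * A * B)"
    unfolding seq_bounded_def
  proof (intro conjI ballI allI impI)
    fix z assume "z \<in> \<sigma>"
    then have "cmod (f z * g z) \<le> A * B"
      unfolding norm_mult using fA gB nonneg by (intro mult_mono) auto
    then show "cmod (f z * g z) \<le> 2 * A * B"
      using mult_nonneg_nonneg[OF nonneg] by simp
  next
    fix j n assume j: "j < k"
    have *: "cmod (f u * g u - f v * g v) \<le> A * cmod (g u - g v) + cmod (f u - f v) * B"
      if "u \<in> \<sigma>" "v \<in> \<sigma>" for u v
    proof -
      have "f u * g u - f v * g v = f u * (g u - g v) + (f u - f v) * g v"
        by (simp add: algebra_simps)
      then have "cmod (f u * g u - f v * g v) \<le> cmod (f u) * cmod (g u - g v) + cmod (f u - f v) * cmod (g v)"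
        using norm_triangle_ineq by (metis norm_mult)
      also have "\<dots> \<le> A * cmod (g u - g v) + cmod (f u - f v) * B"
        using fA gB that by (intro add_mono mult_right_mono mult_left_mono) auto
      finally show ?thesis .
    qed
    have "(\<Sum>i<n. cmod (f (x j (Suc i)) * g (x j (Suc i)) - f (x j i) * g (x j i)))
        \<le> (\<Sum>i<n. A * cmod (g (x j (Suc i)) - g (x j i)) + cmod (f (x j (Suc i)) - f (x j i)) * B)"
      using ray_enumeration_mem(1)[OF enum j] by (intro sum_mono *)
    also have "\<dots> = A * (\<Sum>i<n. cmod (g (x j (Suc i)) - g (x j i)))
        + (\<Sum>i<n. cmod (f (x j (Suc i)) - f (x j i))) * B"
      by (simp add: sum.distrib sum_distrib_left sum_distrib_right)
    also have "\<dots> \<le> A * B + A * B"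
      using A B j nonneg by (intro add_mono mult_left_mono mult_right_mono) (auto simp: seq_bounded_def)
    finally show "(\<Sum>i<n. cmod (f (x j (Suc i)) * g (x j (Suc i)) - f (x j i) * g (x j i))) \<le> 2 * A * B"
      by simp
  qed
  then show ?thesis
    using assms(2) BV_iff_seq_bounded[OF enum] by (auto simp: BV_def)
qed

lemma BV_indicator_sequence:
  assumes enum: "ray_enumeration k \<sigma> x" and "j < k"
  shows "(\<lambda>z. of_bool (z \<in> range (x j))) \<in> BV \<sigma>"
proof -
  have "x i n \<in> range (x j) \<longleftrightarrow> i = j" if "i < k" for i n
    using ray_enumeration_eq_iff[OF enum that assms(2)] by auto
  then have "seq_bounded k x \<sigma> (\<lambda>z. of_bool (z \<in> range (x j))) 1"
    by (simp add: seq_bounded_def)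
  then show ?thesis
    unfolding BV_iff_seq_bounded[OF enum] using ray_enumeration_mem(1)[OF enum assms(2)] by auto
qed

lemma BV_indicator_initial:
  assumes enum: "ray_enumeration k \<sigma> x" and "j < k"
  shows "(\<lambda>z. of_bool (z \<in> x j ` {..n})) \<in> BV \<sigma>"
proof -
  have mem: "x i m \<in> x j ` {..n} \<longleftrightarrow> i = j \<and> m \<le> n" if "i < k" for i m
    using ray_enumeration_eq_iff[OF enum that assms(2)] by auto
  have "(\<Sum>m<N. cmod (of_bool (x i (Suc m) \<in> x j ` {..n}) - of_bool (x i m \<in> x j ` {..n}))) \<le> 1"
    if "i < k" for i N
  proof -
    have "(\<Sum>m<N. cmod (of_bool (x i (Suc m) \<in> x j ` {..n}) - of_bool (x i m \<in> x j ` {..n})))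
        \<le> (\<Sum>m<N. if m = n then 1 else 0)"
      by (intro sum_mono) (auto simp: mem[OF that])
    also have "\<dots> \<le> 1" by simp
    finally show ?thesis .
  qed
  then have "seq_bounded k x \<sigma> (\<lambda>z. of_bool (z \<in> x j ` {..n})) 1"
    by (simp add: seq_bounded_def)
  then show ?thesis
    unfolding BV_iff_seq_bounded[OF enum] using ray_enumeration_mem(1)[OF enum assms(2)] by auto
qed

text \<open>Every change between the values \<open>0\<close> and \<open>1\<close> contributes \<open>1\<close> to the variation along the sequence,
  so there are finitely many changes.\<close>

lemma BV_idempotent_eventually_one:
  assumes enum: "ray_enumeration k \<sigma> x" and "j < k" and G: "G \<in> BV \<sigma>"
    and idem: "\<And>z. G z = 0 \<or> G z = 1"
    and inf: "infinite {n. G (x j n) \<noteq> 0}"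
  shows "\<forall>\<^sub>F n in sequentially. G (x j n) = 1"
proof -
  obtain B where "seq_bounded k x \<sigma> G B"
    using G BV_iff_seq_bounded[OF enum] by blast
  then have "summable (\<lambda>i. cmod (G (x j (Suc i)) - G (x j i)))"
    using \<open>j < k\<close> by (intro summableI_nonneg_bounded[of _ B]) (auto simp: seq_bounded_def)
  then have "(\<lambda>i. cmod (G (x j (Suc i)) - G (x j i))) \<longlonglongrightarrow> 0"
    by (rule summable_LIMSEQ_zero)
  then have "\<forall>\<^sub>F i in sequentially. cmod (G (x j (Suc i)) - G (x j i)) < 1"
    by (rule order_tendstoD) simp
  then obtain N where N: "\<And>i. N \<le> i \<Longrightarrow> cmod (G (x j (Suc i)) - G (x j i)) < 1"
    by (auto simp: eventually_sequentially)
  have step: "G (x j (Suc i)) = G (x j i)" if "N \<le> i" for i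
    using N[OF that] idem[of "x j (Suc i)"] idem[of "x j i"] by auto
  obtain M where M: "N \<le> M" "G (x j M) \<noteq> 0"
    using inf by (auto simp: infinite_nat_iff_unbounded_le)
  have "G (x j n) = 1" if "M \<le> n" for n
    using that
  proof (induction rule: dec_induct)
    case base
    show ?case using M idem by blast
  next
    case (step n)
    then show ?case using \<open>\<And>i. N \<le> i \<Longrightarrow> G (x j (Suc i)) = G (x j i)\<close>[of n] M by simp
  qed
  then show ?thesis
    unfolding eventually_sequentially by blast
qed

text \<open>The indicators \<open>e j\<close> of the sequences are orthogonal idempotents, and each of them lies above the
  infinitely many idempotents \<open>e' j n\<close>. A multiplicative bijection preserves all of this. An idempotent
  of finite support lies above finitely many idempotents only, so \<open>\<Phi> (e j)\<close> has infinite support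
  and is therefore eventually \<open>1\<close> along some sequence \<open>p j\<close> of \<open>\<tau>\<close>. By orthogonality \<open>p\<close> is
  injective.\<close>

lemma multiplicative_bijection_rays_le:
  assumes \<sigma>: "ray_enumeration k \<sigma> x" and \<tau>: "ray_enumeration l \<tau> y"
    and bij: "bij_betw \<Phi> (BV \<sigma>) (BV \<tau>)"
    and mult: "\<And>f g. f \<in> BV \<sigma> \<Longrightarrow> g \<in> BV \<sigma> \<Longrightarrow> \<Phi> (\<lambda>z. f z * g z) = (\<lambda>w. \<Phi> f w * \<Phi> g w)"
  shows "k \<le> l"
proof -
  define e :: "nat \<Rightarrow> complex \<Rightarrow> complex" where "e j z = of_bool (z \<in> range (x j))" for j z
  define e' :: "nat \<Rightarrow> nat \<Rightarrow> complex \<Rightarrow> complex" where "e' j n z = of_bool (z \<in> x j ` {..n})" for j n z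
  have e: "e j \<in> BV \<sigma>" and e': "e' j n \<in> BV \<sigma>" if "j < k" for j n
    using BV_indicator_sequence[OF \<sigma> that] BV_indicator_initial[OF \<sigma> that]
    by (simp_all add: e_def[abs_def] e'_def[abs_def])
  have zero_BV: "(\<lambda>z. 0) \<in> BV \<sigma>" "(\<lambda>w. 0) \<in> BV \<tau>"
    unfolding BV_iff_seq_bounded[OF \<sigma>] BV_iff_seq_bounded[OF \<tau>]
    by (auto simp: seq_bounded_def)
  have \<Phi>_BV: "\<Phi> f \<in> BV \<tau>" if "f \<in> BV \<sigma>" for f
    using bij that bij_betwE by blast
  have \<Phi>_zero: "\<Phi> (\<lambda>z. 0) = (\<lambda>w. 0)"
  proof -
    obtain g where "g \<in> BV \<sigma>" "\<Phi> g = (\<lambda>w. 0)"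
      using bij zero_BV by (metis bij_betw_imp_surj_on imageE)
    then show ?thesis
      using mult[of g "\<lambda>z. 0"] zero_BV by simp
  qed
  have idem: "\<Phi> f w = 0 \<or> \<Phi> f w = 1" if "f \<in> BV \<sigma>" "\<And>z. f z * f z = f z" for f w
  proof -
    have "\<Phi> f w = \<Phi> f w * \<Phi> f w"
      using fun_cong[OF mult[OF that(1) that(1)], of w] that(2) by simp
    then show ?thesis by simp
  qed
  have idem_e: "\<Phi> (e j) w = 0 \<or> \<Phi> (e j) w = 1" if "j < k" for j w
    using e[OF that] by (rule idem) (simp add: e_def)
  have "\<exists>p<l. \<forall>\<^sub>F n in sequentially. \<Phi> (e j) (y p n) = 1" if j: "j < k" for j
  proof -
    define W where "W = {w. \<Phi> (e j) w \<noteq> 0}"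
    have "infinite W"
    proof
      assume "finite W"
      have "\<Phi> (e' j n) \<in> (\<lambda>A w. of_bool (w \<in> A)) ` Pow W" for n
      proof -
        have vals: "\<Phi> (e' j n) w = 0 \<or> \<Phi> (e' j n) w = 1" for w
          using e'[OF j] by (rule idem) (simp add: e'_def)
        have "(\<lambda>z. e' j n z * e j z) = e' j n"
          by (auto simp: e_def e'_def fun_eq_iff)
        then have "\<Phi> (e' j n) w = \<Phi> (e' j n) w * \<Phi> (e j) w" for w
          using fun_cong[OF mult[OF e'[OF j, of n] e[OF j]], of w] by simp
        then have "{w. \<Phi> (e' j n) w \<noteq> 0} \<subseteq> W"
          unfolding W_def by force
        moreover have "\<Phi> (e' j n) = (\<lambda>w. of_bool (w \<in> {w. \<Phi> (e' j n) w \<noteq> 0}))"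
        proof
          fix w
          show "\<Phi> (e' j n) w = of_bool (w \<in> {w. \<Phi> (e' j n) w \<noteq> 0})"
            using vals[of w] by auto
        qed
        ultimately show ?thesis by blast
      qed
      then have "range (\<lambda>n. \<Phi> (e' j n)) \<subseteq> (\<lambda>A w. of_bool (w \<in> A)) ` Pow W"
        by blast
      then have "finite (range (\<lambda>n. \<Phi> (e' j n)))"
        using \<open>finite W\<close> by (meson finite_Pow_iff finite_imageI finite_subset)
      moreover have "inj (\<lambda>n. \<Phi> (e' j n))"
      proof (rule linorder_injI)
        fix m n :: nat assume "m < n"
        then have "e' j m (x j n) \<noteq> e' j n (x j n)"
          using ray_enumeration_eq_iff[OF \<sigma> j j] by (auto simp: e'_def)
        then have "e' j m \<noteq> e' j n" by metis
        then show "\<Phi> (e' j m) \<noteq> \<Phi> (e' j n)"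
          using bij e'[OF j] by (metis bij_betw_imp_inj_on inj_onD)
      qed
      ultimately show False
        using finite_imageD by blast
    qed
    have W_sub: "W \<subseteq> insert 0 (\<Union>p<l. y p ` {n. \<Phi> (e j) (y p n) \<noteq> 0})"
    proof
      fix w assume w: "w \<in> W"
      then have "w \<in> \<tau>"
        using \<Phi>_BV[OF e[OF j]] by (auto simp: W_def BV_def)
      with \<tau> show "w \<in> insert 0 (\<Union>p<l. y p ` {n. \<Phi> (e j) (y p n) \<noteq> 0})"
        by (cases rule: ray_enumeration_cases) (use w in \<open>auto simp: W_def\<close>)
    qed
    have "\<exists>p<l. infinite {n. \<Phi> (e j) (y p n) \<noteq> 0}"
    proof (rule ccontr)
      assume "\<not> ?thesis"
      then have "finite (insert 0 (\<Union>p<l. y p ` {n. \<Phi> (e j) (y p n) \<noteq> 0}))"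
        by auto
      with W_sub \<open>infinite W\<close> show False
        using finite_subset by blast
    qed
    then show ?thesis
      using BV_idempotent_eventually_one[OF \<tau> _ \<Phi>_BV[OF e[OF j]] idem_e[OF j]] by blast
  qed
  then obtain p where p: "\<And>j. j < k \<Longrightarrow> p j < l"
      "\<And>j. j < k \<Longrightarrow> \<forall>\<^sub>F n in sequentially. \<Phi> (e j) (y (p j) n) = 1"
    by metis
  have "inj_on p {..<k}"
  proof (rule inj_onI, rule ccontr)
    fix i j assume ij: "i \<in> {..<k}" "j \<in> {..<k}" "p i = p j" "i \<noteq> j"
    then have "i < k" "j < k" by auto
    have "(\<lambda>z. e i z * e j z) = (\<lambda>z. 0)"
      using ray_enumeration_eq_iff[OF \<sigma> \<open>i < k\<close> \<open>j < k\<close>] ij(4)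
      by (auto simp: e_def fun_eq_iff)
    then have product: "\<Phi> (e i) w * \<Phi> (e j) w = 0" for w
      using fun_cong[OF mult[OF e[OF \<open>i < k\<close>] e[OF \<open>j < k\<close>]], of w] \<Phi>_zero by simp
    have "\<forall>\<^sub>F n in sequentially. \<Phi> (e i) (y (p i) n) = 1 \<and> \<Phi> (e j) (y (p i) n) = 1"
      using p(2)[OF \<open>i < k\<close>] p(2)[OF \<open>j < k\<close>] ij(3) by (simp add: eventually_conj)
    then obtain n where "\<Phi> (e i) (y (p i) n) = 1" "\<Phi> (e j) (y (p i) n) = 1"
      by (auto simp: eventually_sequentially)
    with product[of "y (p i) n"] show False by simp
  qed
  moreover have "p ` {..<k} \<subseteq> {..<l}"
    using p(1) by auto
  ultimately have "card {..<k} \<le> card {..<l}"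
    by (intro card_inj_on_le) auto
  then show ?thesis by simp
qed

theorem corollary5p12:
  fixes k l :: nat and \<sigma> \<tau> :: "complex set"
  assumes "k \<ge> 1" and "l \<ge> 1"
    and "ray_set k \<sigma>" and "ray_set l \<tau>"
  shows "BV_isomorphic \<sigma> \<tau> \<longleftrightarrow> k = l"
proof -
  obtain x where x: "ray_enumeration k \<sigma> x"
    using ray_set_enumeration assms by metis
  obtain y where y: "ray_enumeration l \<tau> y"
    using ray_set_enumeration assms by metis
  show ?thesis
  proof
    assume "k = l"
    with x y show "BV_isomorphic \<sigma> \<tau>"
      by (auto intro: BV_isomorphic_same_rays)
  next
    assume "BV_isomorphic \<sigma> \<tau>"
    then obtain \<Phi> where bij: "bij_betw \<Phi> (BV \<sigma>) (BV \<tau>)"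
      and mult: "\<And>f g. f \<in> BV \<sigma> \<Longrightarrow> g \<in> BV \<sigma> \<Longrightarrow> \<Phi> (\<lambda>z. f z * g z) = (\<lambda>w. \<Phi> f w * \<Phi> g w)"
      unfolding BV_isomorphic_def by blast
    let ?\<Psi> = "inv_into (BV \<sigma>) \<Phi>"
    have "?\<Psi> (\<lambda>w. f w * g w) = (\<lambda>z. ?\<Psi> f z * ?\<Psi> g z)" if "f \<in> BV \<tau>" "g \<in> BV \<tau>" for f g
    proof (rule inv_into_f_eq)
      have \<Psi>: "?\<Psi> f \<in> BV \<sigma>" "?\<Psi> g \<in> BV \<sigma>" "\<Phi> (?\<Psi> f) = f" "\<Phi> (?\<Psi> g) = g"
        using bij that by (auto simp: bij_betw_def inv_into_into f_inv_into_f)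
      show "inj_on \<Phi> (BV \<sigma>)"
        using bij by (rule bij_betw_imp_inj_on)
      show "(\<lambda>z. ?\<Psi> f z * ?\<Psi> g z) \<in> BV \<sigma>"
        using x \<Psi>(1,2) by (rule BV_mult)
      show "\<Phi> (\<lambda>z. ?\<Psi> f z * ?\<Psi> g z) = (\<lambda>w. f w * g w)"
        using mult[OF \<Psi>(1,2)] \<Psi>(3,4) by simp
    qed
    then have "l \<le> k"
      using multiplicative_bijection_rays_le[OF y x bij_betw_inv_into[OF bij]] by blast
    moreover have "k \<le> l"
      using multiplicative_bijection_rays_le[OF x y bij mult] by blast
    ultimately show "k = l" by simp
  qed
qed

end
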